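(* Let $K$ be a Pythagorean subfield of $\mathbb{R}$, let $t$ be transcendental over $K$, and let $r\in K$ be recursively approximable. Then $\{r\}$ is $\emptyset$-definable in $(K(t),+,\cdot,0,1)$.
   Context: A subfield $K$ of $\mathbb{R}$ is said to be Pythagorean (in the sense used here) if for every $x\in K$ with $0\le x$ there exists $y\in K$ with $x=y^2$. A real number $r$ is called recursively approximable if there exists a computable sequence of rational numbers which converges to $r$ (no condition on the rate of convergence). A set is $\emptyset$-definable in a structure if it is definable by a first-order formula without parameters in the language of that structure. *)

theory Defs
  imports Complex_Main "HOL-Computational_Algebra.Polynomial"
begin

section \<open>Subfields and simple transcendental extensions\<close>

definition is_subfield :: "'a::field set \<Rightarrow> bool" where
  "is_subfield F \<longleftrightarrow> 0 \<in> F \<and> 1 \<in> F \<and>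
     (\<forall>x\<in>F. \<forall>y\<in>F. x + y \<in> F \<and> x * y \<in> F) \<and>
     (\<forall>x\<in>F. - x \<in> F) \<and> (\<forall>x\<in>F. x \<noteq> 0 \<longrightarrow> inverse x \<in> F)"

definition pythagorean_subfield :: "real set \<Rightarrow> bool" where
  "pythagorean_subfield K \<longleftrightarrow> is_subfield K \<and> (\<forall>x\<in>K. 0 \<le> x \<longrightarrow> (\<exists>y\<in>K. x = y\<^sup>2))"

text \<open>Only the values of \<open>\<iota>\<close> on the subfield \<open>K\<close> matter. A unital homomorphism
  out of a field is injective, so injectivity need not be demanded.\<close>

definition field_embedding_on :: "'a::field set \<Rightarrow> ('a \<Rightarrow> 'b::field) \<Rightarrow> bool" where
  "field_embedding_on K \<iota> \<longleftrightarrow> \<iota> 1 = 1 \<and>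
     (\<forall>x\<in>K. \<forall>y\<in>K. \<iota> (x + y) = \<iota> x + \<iota> y \<and> \<iota> (x * y) = \<iota> x * \<iota> y)"

definition transcendental_over :: "'a::field set \<Rightarrow> 'a \<Rightarrow> bool" where
  "transcendental_over k t \<longleftrightarrow> (\<forall>p. (\<forall>i. coeff p i \<in> k) \<and> p \<noteq> 0 \<longrightarrow> poly p t \<noteq> 0)"

definition field_adjoin :: "'a::field set \<Rightarrow> 'a \<Rightarrow> 'a set" where
  "field_adjoin k t = \<Inter>{F. is_subfield F \<and> insert t k \<subseteq> F}"

lemma is_subfield_field_adjoin: "is_subfield (field_adjoin k t)"
  unfolding field_adjoin_def is_subfield_def by auto

lemma subset_field_adjoin: "insert t k \<subseteq> field_adjoin k t"
  unfolding field_adjoin_def by auto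


section \<open>First-order definability in the language \<open>(+, \<cdot>, 0, 1)\<close>\<close>

datatype rterm = TVar nat | TZero | TOne | TAdd rterm rterm | TMul rterm rterm

datatype rformula =
    FEq rterm rterm
  | FNot rformula
  | FAnd rformula rformula
  | FEx nat rformula

fun term_val :: "(nat \<Rightarrow> 'a::comm_ring_1) \<Rightarrow> rterm \<Rightarrow> 'a" where
  "term_val e (TVar i) = e i"
| "term_val e TZero = 0"
| "term_val e TOne = 1"
| "term_val e (TAdd s t) = term_val e s + term_val e t"
| "term_val e (TMul s t) = term_val e s * term_val e t"

text \<open>Satisfaction in the structure with universe \<open>A\<close> and the ring operations inherited from
  the ambient type; \<open>A\<close> is meant to be closed under these operations.\<close>

fun sat :: "'a::comm_ring_1 set \<Rightarrow> (nat \<Rightarrow> 'a) \<Rightarrow> rformula \<Rightarrow> bool" where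
  "sat A e (FEq s t) \<longleftrightarrow> term_val e s = term_val e t"
| "sat A e (FNot f) \<longleftrightarrow> \<not> sat A e f"
| "sat A e (FAnd f g) \<longleftrightarrow> sat A e f \<and> sat A e g"
| "sat A e (FEx i f) \<longleftrightarrow> (\<exists>a\<in>A. sat A (e(i := a)) f)"

fun term_vars :: "rterm \<Rightarrow> nat set" where
  "term_vars (TVar i) = {i}"
| "term_vars TZero = {}"
| "term_vars TOne = {}"
| "term_vars (TAdd s t) = term_vars s \<union> term_vars t"
| "term_vars (TMul s t) = term_vars s \<union> term_vars t"

fun free_vars :: "rformula \<Rightarrow> nat set" where
  "free_vars (FEq s t) = term_vars s \<union> term_vars t"
| "free_vars (FNot f) = free_vars f"
| "free_vars (FAnd f g) = free_vars f \<union> free_vars g"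
| "free_vars (FEx i f) = free_vars f - {i}"

lemma term_val_cong: "(\<And>i. i \<in> term_vars s \<Longrightarrow> e i = e' i) \<Longrightarrow> term_val e s = term_val e' s"
  by (induction s) auto

lemma sat_cong: "(\<And>i. i \<in> free_vars f \<Longrightarrow> e i = e' i) \<Longrightarrow> sat A e f = sat A e' f"
proof (induction f arbitrary: e e')
  case (FEq s t)
  then show ?case using term_val_cong[of s e e'] term_val_cong[of t e e'] by simp
next
  case (FEx i f)
  have "sat A (e(i := a)) f = sat A (e'(i := a)) f" for a
    by (rule FEx.IH) (use FEx.prems in auto)
  then show ?case by simp
next
  case (FNot f)
  then show ?case by (metis free_vars.simps(2) sat.simps(2))
next
  case (FAnd f g)
  then show ?case by (metis UnCI free_vars.simps(3) sat.simps(3))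
qed

text \<open>At most the variable \<open>0\<close> is free in \<open>f\<close>, so the values of the assignment elsewhere
  are irrelevant (lemma \<open>sat_cong\<close>).\<close>

definition empty_definable :: "'a::comm_ring_1 set \<Rightarrow> 'a set \<Rightarrow> bool" where
  "empty_definable A S \<longleftrightarrow>
     (\<exists>f. free_vars f \<subseteq> {0} \<and> S = {a \<in> A. sat A (\<lambda>_. a) f})"


section \<open>Recursively approximable real numbers\<close>

text \<open>Partial recursive functions: \<open>computes c xs y\<close> says that the partial function described
  by \<open>c\<close> is defined at \<open>xs\<close> with value \<open>y\<close>. Ill-formed applications have no value. In
  \<open>RPrec\<close> and \<open>RMu\<close> the recursion, resp. search, variable is the first argument.\<close>

datatype recfn =
    RZero
  | RSuc
  | RProj nat
  | RComp recfn "recfn list"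
  | RPrec recfn recfn
  | RMu recfn

inductive computes :: "recfn \<Rightarrow> nat list \<Rightarrow> nat \<Rightarrow> bool" where
  zero: "computes RZero xs 0"
| suc: "computes RSuc [x] (Suc x)"
| proj: "i < length xs \<Longrightarrow> computes (RProj i) xs (xs ! i)"
| comp: "list_all2 (\<lambda>g y. computes g xs y) gs ys \<Longrightarrow> computes f ys z \<Longrightarrow>
    computes (RComp f gs) xs z"
| prec_0: "computes f xs y \<Longrightarrow> computes (RPrec f g) (0 # xs) y"
| prec_Suc: "computes (RPrec f g) (n # xs) u \<Longrightarrow> computes g (n # u # xs) y \<Longrightarrow>
    computes (RPrec f g) (Suc n # xs) y"
| mu: "computes f (n # xs) 0 \<Longrightarrow> (\<And>m. m < n \<Longrightarrow> \<exists>k. computes f (m # xs) (Suc k)) \<Longrightarrow>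
    computes (RMu f) xs n"

inductive_cases computes_ZeroE: "computes RZero xs z"
inductive_cases computes_SucE: "computes RSuc xs z"
inductive_cases computes_ProjE: "computes (RProj i) xs z"
inductive_cases computes_CompE: "computes (RComp f gs) xs z"
inductive_cases computes_Prec0E: "computes (RPrec f g) (0 # xs) z"
inductive_cases computes_PrecSucE: "computes (RPrec f g) (Suc n # xs) z"
inductive_cases computes_MuE: "computes (RMu f) xs z"

lemma computes_deterministic: "computes c xs y \<Longrightarrow> computes c xs z \<Longrightarrow> y = z"
proof (induction arbitrary: z rule: computes.induct)
  case (zero xs)
  then show ?case by (rule computes_ZeroE) simp
next
  case (suc x)
  then show ?case by (rule computes_SucE) simp
next
  case (proj i xs)
  from proj.prems show ?case by (rule computes_ProjE) simp
next
  case (comp xs gs ys f v)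
  from comp.prems obtain ys' where ys': "list_all2 (\<lambda>g y. computes g xs y) gs ys'"
    and f: "computes f ys' z"
    by (rule computes_CompE)
  have "ys = ys'"
  proof (rule nth_equalityI)
    show "length ys = length ys'"
      using list_all2_lengthD[OF comp.IH(1)] list_all2_lengthD[OF ys'] by linarith
    show "ys ! i = ys' ! i" if "i < length ys" for i
    proof -
      have len: "length gs = length ys"
        using comp.IH(1) by (rule list_all2_lengthD)
      have "computes (gs ! i) xs (ys' ! i)"
        using list_all2_nthD[OF ys', of i] that len by simp
      then show ?thesis
        using list_all2_nthD[OF comp.IH(1), of i] that unfolding len by blast
    qed
  qed
  with f have "computes f ys z" by (simp only:)
  then show ?case by (rule comp.IH(2))
next
  case (prec_0 f xs y g)
  from prec_0.prems have "computes f xs z" by (rule computes_Prec0E)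
  then show ?case by (rule prec_0.IH)
next
  case (prec_Suc f g n xs u y)
  from prec_Suc.prems obtain u' where "computes (RPrec f g) (n # xs) u'"
    and "computes g (n # u' # xs) z"
    by (rule computes_PrecSucE)
  then show ?case using prec_Suc.IH(1)[of u'] prec_Suc.IH(2) by blast
next
  case (mu f n xs)
  from mu.prems have z0: "computes f (z # xs) 0"
    and zlt: "\<And>m. m < z \<Longrightarrow> \<exists>k. computes f (m # xs) (Suc k)"
    by (rule computes_MuE, simp)+
  have "\<not> z < n"
  proof
    assume "z < n"
    from mu.IH(2)[OF this] z0 have "\<exists>k. Suc k = 0" by blast
    then show False by simp
  qed
  moreover have "\<not> n < z"
  proof
    assume "n < z"
    from zlt[OF this] mu.IH(1) have "\<exists>k. 0 = Suc k" by blast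
    then show False by simp
  qed
  ultimately show ?case by linarith
qed

definition computable_fun :: "(nat \<Rightarrow> nat) \<Rightarrow> bool" where
  "computable_fun f \<longleftrightarrow> (\<exists>c. \<forall>n. computes c [n] (f n))"

definition computable_rat_seq :: "(nat \<Rightarrow> rat) \<Rightarrow> bool" where
  "computable_rat_seq q \<longleftrightarrow>
     (\<exists>s a b. computable_fun s \<and> computable_fun a \<and> computable_fun b \<and>
        (\<forall>n. b n \<noteq> 0 \<and> q n = (- 1) ^ s n * of_nat (a n) / of_nat (b n)))"

definition recursively_approximable :: "real \<Rightarrow> bool" where
  "recursively_approximable r \<longleftrightarrow>
     (\<exists>q. computable_rat_seq q \<and> (\<lambda>n. real_of_rat (q n)) \<longlonglongrightarrow> r)"

end

theory Submission
  imports
    Defs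
    "HOL-Computational_Algebra.Polynomial_Factorial"
    "HOL-Computational_Algebra.Field_as_Ring"
    "HOL-Number_Theory.Cong"
begin

text \<open>The constants \<open>K\<close> are the \<open>x\<close> for which \<open>1 + x\<^sup>4\<close> is a square, and they are ordered by their
  squares. For \<open>c \<in> K\<close>, if \<open>\<plusminus>F = (t - c) (x\<^sup>2 - (4 (t - c)\<^sup>2 - 1) y\<^sup>2)\<close> with \<open>x, y \<in> K(t)\<close>, then the second
  factor is nonnegative near \<open>c\<close>, so \<open>F\<close> has odd order at \<open>c\<close>; only finitely many \<open>c\<close> are
  possible if \<open>F \<noteq> 0\<close>. On the other hand each \<open>\<plusminus>(t - j)\<close> with \<open>j \<noteq> k\<close> is, for the appropriate sign,
  of the form \<open>x\<^sup>2 - (4 (t - k)\<^sup>2 - 1) y\<^sup>2\<close>, so that for \<open>F = t (t - 1) \<cdots> (t - n)\<close> these \<open>c\<close> are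
  exactly \<open>0, \<dots>, n\<close>. Finite sets closed under predecessors down to \<open>0\<close> consist of naturals, which
  defines \<open>\<nat>\<close> from \<open>t\<close>. The parameter \<open>t\<close> is eliminated by intersecting over all parameters \<open>T\<close>
  whose associated set is inductive. Since \<open>\<nat>\<close> is definable, so are all recursive functions, and
  \<open>r\<close> is the unique constant to which the given rational sequence converges.\<close>

section \<open>Definable predicates\<close>

lemma finite_term_vars: "finite (term_vars s)"
  by (induction s) auto

lemma finite_free_vars: "finite (free_vars f)"
  by (induction f) (auto simp: finite_term_vars)

section \<open>Substitution of terms in formulas\<close>

fun term_subst :: "(nat \<Rightarrow> rterm) \<Rightarrow> rterm \<Rightarrow> rterm" where
  "term_subst \<sigma> (TVar i) = \<sigma> i"
| "term_subst \<sigma> TZero = TZero"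
| "term_subst \<sigma> TOne = TOne"
| "term_subst \<sigma> (TAdd s t) = TAdd (term_subst \<sigma> s) (term_subst \<sigma> t)"
| "term_subst \<sigma> (TMul s t) = TMul (term_subst \<sigma> s) (term_subst \<sigma> t)"

lemma term_val_subst: "term_val e (term_subst \<sigma> s) = term_val (\<lambda>i. term_val e (\<sigma> i)) s"
  by (induction s) auto

lemma term_vars_subst: "term_vars (term_subst \<sigma> s) = (\<Union>j\<in>term_vars s. term_vars (\<sigma> j))"
  by (induction s) auto

text \<open>Stated through satisfaction, so that the renaming of bound variables stays hidden in the
  existence claim. Under a quantifier the bound variable is replaced by one that occurs in none of
  the substituted terms; this changes the substitution, so the induction is over all
  \<open>\<sigma>\<close>.\<close>

lemma formula_subst:
  fixes A :: "'a::comm_ring_1 set"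
  shows "\<exists>f'. free_vars f' \<subseteq> (\<Union>j\<in>free_vars f. term_vars (\<sigma> j)) \<and>
    (\<forall>e. sat A e f' \<longleftrightarrow> sat A (\<lambda>i. term_val e (\<sigma> i)) f)"
proof (induction f arbitrary: \<sigma>)
  case (FEq s u)
  show ?case
    by (rule exI[of _ "FEq (term_subst \<sigma> s) (term_subst \<sigma> u)"])
      (auto simp: term_vars_subst term_val_subst)
next
  case (FNot f)
  obtain f' where "free_vars f' \<subseteq> (\<Union>j\<in>free_vars f. term_vars (\<sigma> j))"
    "\<forall>e. sat A e f' \<longleftrightarrow> sat A (\<lambda>i. term_val e (\<sigma> i)) f"
    using FNot.IH[of \<sigma>] by blast
  then show ?case by (intro exI[of _ "FNot f'"]) simp
next
  case (FAnd f g)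
  obtain f' where "free_vars f' \<subseteq> (\<Union>j\<in>free_vars f. term_vars (\<sigma> j))"
    "\<forall>e. sat A e f' \<longleftrightarrow> sat A (\<lambda>i. term_val e (\<sigma> i)) f"
    using FAnd.IH(1)[of \<sigma>] by blast
  moreover obtain g' where "free_vars g' \<subseteq> (\<Union>j\<in>free_vars g. term_vars (\<sigma> j))"
    "\<forall>e. sat A e g' \<longleftrightarrow> sat A (\<lambda>i. term_val e (\<sigma> i)) g"
    using FAnd.IH(2)[of \<sigma>] by blast
  ultimately show ?case
    by (intro exI[of _ "FAnd f' g'"]) (simp add: le_supI1 le_supI2)
next
  case (FEx i f)
  have "finite (\<Union>j\<in>free_vars f. term_vars (\<sigma> j))"
    by (simp add: finite_free_vars finite_term_vars)
  then obtain z where z: "z \<notin> (\<Union>j\<in>free_vars f. term_vars (\<sigma> j))"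
    using ex_new_if_finite[OF infinite_UNIV_nat] by blast
  obtain f' where f': "free_vars f' \<subseteq> (\<Union>j\<in>free_vars f. term_vars ((\<sigma>(i := TVar z)) j))"
    "\<And>e. sat A e f' \<longleftrightarrow> sat A (\<lambda>j. term_val e ((\<sigma>(i := TVar z)) j)) f"
    using FEx.IH[of "\<sigma>(i := TVar z)"] by blast
  have "sat A (e(z := a)) f' \<longleftrightarrow> sat A ((\<lambda>j. term_val e (\<sigma> j))(i := a)) f" for e a
    unfolding f'(2)
  proof (rule sat_cong)
    fix j assume j: "j \<in> free_vars f"
    then have "z \<notin> term_vars (\<sigma> j)" using z by blast
    then have "term_val (e(z := a)) (\<sigma> j) = term_val e (\<sigma> j)"
      by (intro term_val_cong) auto
    then show "term_val (e(z := a)) ((\<sigma>(i := TVar z)) j) = ((\<lambda>j. term_val e (\<sigma> j))(i := a)) j"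
      by simp
  qed
  moreover have "free_vars f' - {z} \<subseteq> (\<Union>j\<in>free_vars f - {i}. term_vars (\<sigma> j))"
  proof
    fix x assume x: "x \<in> free_vars f' - {z}"
    then obtain j where "j \<in> free_vars f" "x \<in> term_vars ((\<sigma>(i := TVar z)) j)"
      using f'(1) by blast
    with x show "x \<in> (\<Union>j\<in>free_vars f - {i}. term_vars (\<sigma> j))"
      by (cases "j = i") auto
  qed
  ultimately show ?case by (intro exI[of _ "FEx z f'"]) simp
qed

section \<open>Closure properties of definable predicates\<close>

definition polynomial_fun :: "((nat \<Rightarrow> 'a::comm_ring_1) \<Rightarrow> 'a) \<Rightarrow> bool" where
  "polynomial_fun T \<longleftrightarrow> (\<exists>s. \<forall>e. T e = term_val e s)"

text \<open>The assignment ranges over the whole ambient type; only quantified variables are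
  confined to \<open>A\<close>. Free variables of the formula are not tracked here but cut down at
  the end, in \<open>empty_definable_if_definable_pred\<close>.\<close>

definition definable_pred :: "'a::comm_ring_1 set \<Rightarrow> ((nat \<Rightarrow> 'a) \<Rightarrow> bool) \<Rightarrow> bool" where
  "definable_pred A P \<longleftrightarrow> (\<exists>f. \<forall>e. sat A e f \<longleftrightarrow> P e)"

named_theorems definable_intros

lemma polynomial_fun_var [definable_intros]: "polynomial_fun (\<lambda>e. e i)"
  unfolding polynomial_fun_def by (rule exI[of _ "TVar i"]) simp

lemma polynomial_fun_zero [definable_intros]: "polynomial_fun (\<lambda>e. 0)"
  unfolding polynomial_fun_def by (rule exI[of _ TZero]) simp

lemma polynomial_fun_one [definable_intros]: "polynomial_fun (\<lambda>e. 1)"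
  unfolding polynomial_fun_def by (rule exI[of _ TOne]) simp

lemma polynomial_fun_add [definable_intros]:
  assumes "polynomial_fun T" "polynomial_fun U"
  shows "polynomial_fun (\<lambda>e. T e + U e)"
proof -
  obtain s u where "\<forall>e. T e = term_val e s" "\<forall>e. U e = term_val e u"
    using assms unfolding polynomial_fun_def by blast
  then show ?thesis unfolding polynomial_fun_def by (intro exI[of _ "TAdd s u"]) simp
qed

lemma polynomial_fun_mult [definable_intros]:
  assumes "polynomial_fun T" "polynomial_fun U"
  shows "polynomial_fun (\<lambda>e. T e * U e)"
proof -
  obtain s u where "\<forall>e. T e = term_val e s" "\<forall>e. U e = term_val e u"
    using assms unfolding polynomial_fun_def by blast
  then show ?thesis unfolding polynomial_fun_def by (intro exI[of _ "TMul s u"]) simp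
qed

lemma definable_pred_eq [definable_intros]:
  assumes "polynomial_fun T" "polynomial_fun U"
  shows "definable_pred A (\<lambda>e. T e = U e)"
proof -
  obtain s u where "\<forall>e. T e = term_val e s" "\<forall>e. U e = term_val e u"
    using assms unfolding polynomial_fun_def by blast
  then show ?thesis unfolding definable_pred_def by (intro exI[of _ "FEq s u"]) simp
qed

lemma definable_pred_not [definable_intros]:
  assumes "definable_pred A P"
  shows "definable_pred A (\<lambda>e. \<not> P e)"
proof -
  obtain f where "\<forall>e. sat A e f \<longleftrightarrow> P e"
    using assms unfolding definable_pred_def by blast
  then show ?thesis unfolding definable_pred_def by (intro exI[of _ "FNot f"]) simp
qed

lemma definable_pred_conj [definable_intros]:
  assumes "definable_pred A P" "definable_pred A Q"
  shows "definable_pred A (\<lambda>e. P e \<and> Q e)"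
proof -
  obtain f g where "\<forall>e. sat A e f \<longleftrightarrow> P e" "\<forall>e. sat A e g \<longleftrightarrow> Q e"
    using assms unfolding definable_pred_def by blast
  then show ?thesis unfolding definable_pred_def by (intro exI[of _ "FAnd f g"]) simp
qed

lemma definable_pred_disj [definable_intros]:
  assumes "definable_pred A P" "definable_pred A Q"
  shows "definable_pred A (\<lambda>e. P e \<or> Q e)"
  using definable_pred_not[OF definable_pred_conj[OF assms[THEN definable_pred_not]]] by simp

lemma definable_pred_imp [definable_intros]:
  assumes "definable_pred A P" "definable_pred A Q"
  shows "definable_pred A (\<lambda>e. P e \<longrightarrow> Q e)"
  using definable_pred_disj[OF definable_pred_not[OF assms(1)] assms(2)] by simp

lemma definable_pred_subst:
  assumes "definable_pred A P" "\<And>i. polynomial_fun (T i)"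
  shows "definable_pred A (\<lambda>e. P (\<lambda>i. T i e))"
proof -
  obtain f where f: "\<And>e. sat A e f \<longleftrightarrow> P e"
    using assms(1) unfolding definable_pred_def by blast
  obtain \<sigma> where \<sigma>: "\<And>i e. T i e = term_val e (\<sigma> i)"
    using assms(2) unfolding polynomial_fun_def by metis
  show ?thesis
    unfolding definable_pred_def \<sigma> f[symmetric]
    using formula_subst[where f = f and \<sigma> = \<sigma> and A = A] by blast
qed

text \<open>This and the next two lemmas allow definability to be shown once, at plain variables,
  and then used with polynomial arguments.\<close>

lemma definable_pred_subst1:
  assumes "definable_pred A (\<lambda>e. R (e 0))" "polynomial_fun T"
  shows "definable_pred A (\<lambda>e. R (T e))"
  using definable_pred_subst[OF assms(1), of "\<lambda>_. T"] assms(2) by simp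

lemma definable_pred_subst2:
  assumes "definable_pred A (\<lambda>e. R (e 0) (e 1))" "polynomial_fun T" "polynomial_fun U"
  shows "definable_pred A (\<lambda>e. R (T e) (U e))"
  using definable_pred_subst[OF assms(1), of "\<lambda>i. if i = 0 then T else U"] assms(2,3) by simp

lemma definable_pred_subst3:
  assumes "definable_pred A (\<lambda>e. R (e 0) (e 1) (e 2))"
    "polynomial_fun T" "polynomial_fun U" "polynomial_fun V"
  shows "definable_pred A (\<lambda>e. R (T e) (U e) (V e))"
  using definable_pred_subst[OF assms(1), of "\<lambda>i. if i = 0 then T else if i = 1 then U else V"]
    assms(2,3,4) by simp

lemma definable_pred_bex_case_nat:
  assumes "definable_pred A P"
  shows "definable_pred A (\<lambda>e. \<exists>a\<in>A. P (case_nat a e))"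
proof -
  obtain f where f: "\<And>e. sat A e f \<longleftrightarrow> P e"
    using assms unfolding definable_pred_def by blast
  have "finite {i. Suc i \<in> free_vars f}"
    using finite_vimageI[OF finite_free_vars[of f] inj_Suc] by (simp add: vimage_def)
  \<comment> \<open>After the shift the old variable \<open>z\<close> is read by \<open>f\<close> at
    index \<open>Suc z\<close>. So this choice ensures that using \<open>z\<close> as the bound
    variable overwrites nothing that \<open>f\<close> depends on.\<close>
  then obtain z where z: "Suc z \<notin> free_vars f"
    using ex_new_if_finite[OF infinite_UNIV_nat] by blast
  obtain f' where f': "\<And>e. sat A e f' \<longleftrightarrow> sat A (\<lambda>i. term_val e (case_nat (TVar z) TVar i)) f"
    using formula_subst[where f = f and \<sigma> = "case_nat (TVar z) TVar" and A = A] by blast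
  have "sat A (e(z := a)) f' \<longleftrightarrow> sat A (case_nat a e) f" for e a
    unfolding f' using z by (intro sat_cong) (auto split: nat.split)
  then have "\<forall>e. sat A e (FEx z f') \<longleftrightarrow> (\<exists>a\<in>A. P (case_nat a e))"
    by (simp add: f)
  then show ?thesis unfolding definable_pred_def by blast
qed

text \<open>Bound variables are handled in de Bruijn style: under a quantifier the new variable is
  \<open>e 0\<close> and the old ones are shifted.\<close>

lemma definable_pred_bex [definable_intros]:
  assumes "definable_pred A (\<lambda>e. Q (e 0) (\<lambda>i. e (Suc i)))"
  shows "definable_pred A (\<lambda>e. \<exists>a\<in>A. Q a e)"
  using definable_pred_bex_case_nat[OF assms] by simp

lemma definable_pred_ball [definable_intros]:
  assumes "definable_pred A (\<lambda>e. Q (e 0) (\<lambda>i. e (Suc i)))"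
  shows "definable_pred A (\<lambda>e. \<forall>a\<in>A. Q a e)"
  using definable_pred_not[OF definable_pred_bex[OF definable_pred_not[OF assms]]] by simp

lemma definable_pred_mem [definable_intros]:
  assumes "polynomial_fun T"
  shows "definable_pred A (\<lambda>e. T e \<in> A)"
proof -
  have "definable_pred A (\<lambda>e. \<exists>a\<in>A. a = e 0)"
    by (rule definable_pred_bex, rule definable_pred_eq; rule polynomial_fun_var)
  then show ?thesis
    using definable_pred_subst1[of A "\<lambda>x. \<exists>a\<in>A. a = x" T] assms by simp
qed

text \<open>Substituting variable 0 for every variable leaves at most one free variable, and the
  truth value is kept because \<open>R\<close> looks at \<open>e 0\<close> only.\<close>

lemma empty_definable_if_definable_pred:
  assumes "definable_pred A (\<lambda>e. R (e 0))"
  shows "empty_definable A {a \<in> A. R a}"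
proof -
  obtain f where f: "\<And>e. sat A e f \<longleftrightarrow> R (e 0)"
    using assms unfolding definable_pred_def by blast
  obtain f' where "free_vars f' \<subseteq> (\<Union>j\<in>free_vars f. term_vars (TVar 0))"
    "\<And>e. sat A e f' \<longleftrightarrow> sat A (\<lambda>i. term_val e (TVar 0)) f"
    using formula_subst[where f = f and \<sigma> = "\<lambda>_. TVar 0" and A = A] by blast
  then show ?thesis
    unfolding empty_definable_def using f by (intro exI[of _ f']) (auto split: if_splits)
qed

section \<open>Arithmetical definability of recursive functions\<close>

definition beta :: "nat \<Rightarrow> nat \<Rightarrow> nat \<Rightarrow> nat" where
  "beta a b i = a mod Suc (Suc i * b)"

text \<open>Goedel's coding of finite sequences: for \<open>b\<close> a large factorial the moduli are pairwise
  coprime.\<close>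

lemma beta_surj: "\<exists>a b. \<forall>i\<le>n. beta a b i = u i"
proof -
  \<comment> \<open>\<open>N\<close> bounds the indices, so that all their differences divide the
    factorial \<open>b\<close>, and also the values \<open>u i\<close>, so that they are smaller
    than the moduli.\<close>
  define N where "N = n + (\<Sum>i\<le>n. u i)"
  define b :: nat where "b = fact (Suc N)"
  have b_ge: "Suc N \<le> b" unfolding b_def by (rule fact_ge_self)
  have u_le: "u i \<le> N" if "i \<le> n" for i
    unfolding N_def using member_le_sum[of i "{..n}" u] that by auto
  have cop: "coprime (Suc (Suc i * b)) (Suc (Suc j * b))" if "i \<le> n" "j < i" for i j
  proof (rule ccontr)
    assume "\<not> ?thesis"
    then obtain p where p: "prime p" "p dvd Suc (Suc i * b)" "p dvd Suc (Suc j * b)"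
      unfolding coprime_iff_gcd_eq_1 using prime_factor_nat by (metis gcd_greatest_iff)
    \<comment> \<open>The difference of the two moduli is \<open>(i - j) * b\<close>, and
      \<open>i - j\<close> divides \<open>b\<close>. Hence \<open>p\<close> divides
      \<open>b\<close>, and then also 1.\<close>
    then have "p dvd Suc (Suc i * b) - Suc (Suc j * b)" by (rule_tac dvd_diff_nat)
    also have "Suc (Suc i * b) - Suc (Suc j * b) = (i - j) * b"
      using that by (simp add: algebra_simps diff_mult_distrib)
    finally have "p dvd i - j \<or> p dvd b" using p(1) by (simp add: prime_dvd_mult_iff)
    moreover have "i - j dvd b"
      unfolding b_def by (rule dvd_fact) (use that in \<open>auto simp: N_def\<close>)
    ultimately have "p dvd b" using dvd_trans by blast
    then have "p dvd Suc i * b" by simp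
    with p(2) have "p dvd 1" using dvd_diff_nat[of p "Suc (Suc i * b)" "Suc i * b"] by simp
    with p(1) show False by simp
  qed
  have "\<forall>i\<in>{..n}. \<forall>j\<in>{..n}. i \<noteq> j \<longrightarrow> coprime (Suc (Suc i * b)) (Suc (Suc j * b))"
    using cop by (metis atMost_iff coprime_commute linorder_neqE_nat)
  then obtain a where a: "\<forall>i\<in>{..n}. [a = u i] (mod Suc (Suc i * b))"
    using chinese_remainder_nat[of "{..n}" "\<lambda>i. Suc (Suc i * b)" u] by auto
  have "beta a b i = u i" if i: "i \<le> n" for i
  proof -
    have "u i < Suc (Suc i * b)" using u_le[OF i] b_ge by simp
    then show ?thesis using a i unfolding beta_def cong_def by auto
  qed
  then show ?thesis by blast
qed

text \<open>Expresses the remainder by addition, multiplication and order alone, the form needed for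
  arithmetical definability.\<close>

lemma beta_eq_iff: "beta a b i = u \<longleftrightarrow> (\<exists>q. a = q * (1 + (i + 1) * b) + u) \<and> u \<le> (i + 1) * b"
proof
  assume "beta a b i = u"
  then have "a = a div Suc (Suc i * b) * (1 + (i + 1) * b) + u" "u < Suc (Suc i * b)"
    unfolding beta_def using div_mult_mod_eq[of a "Suc (Suc i * b)"] by auto
  then show "(\<exists>q. a = q * (1 + (i + 1) * b) + u) \<and> u \<le> (i + 1) * b"
    by (intro conjI exI[of _ "a div Suc (Suc i * b)"]) auto
next
  assume "(\<exists>q. a = q * (1 + (i + 1) * b) + u) \<and> u \<le> (i + 1) * b"
  then obtain q where "a = u + q * Suc (Suc i * b)" "u < Suc (Suc i * b)" by auto
  then show "beta a b i = u" unfolding beta_def by (simp only: mod_mult_self1 mod_less)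
qed

section \<open>Computations described by their intermediate values\<close>

lemma computes_RComp_iff:
  "computes (RComp f gs) xs z \<longleftrightarrow> (\<exists>ys. length ys = length gs \<and>
     (\<forall>j<length gs. computes (gs ! j) xs (ys ! j)) \<and> computes f ys z)"
  by (auto simp: list_all2_conv_all_nth elim!: computes_CompE intro!: computes.comp)

lemma computes_RMu_iff:
  "computes (RMu f) xs n \<longleftrightarrow>
     computes f (n # xs) 0 \<and> (\<forall>m<n. \<exists>k. computes f (m # xs) (Suc k))"
  by (auto elim!: computes_MuE intro!: computes.mu)

text \<open>The function \<open>u\<close> is the history of the recursion; only its values up to
  \<open>n\<close> are constrained.\<close>

lemma computes_RPrec_iff:
  "computes (RPrec f g) (n # xs) y \<longleftrightarrow> (\<exists>u. computes f xs (u 0) \<and>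
     (\<forall>i<n. computes g (i # u i # xs) (u (Suc i))) \<and> u n = y)"
proof (induction n arbitrary: y)
  case 0
  show ?case
    by (auto elim!: computes_Prec0E intro: computes.prec_0)
next
  case (Suc n)
  show ?case (is "_ = (\<exists>u. ?R u)")
  proof
    assume "computes (RPrec f g) (Suc n # xs) y"
    then obtain v where "computes (RPrec f g) (n # xs) v" and g: "computes g (n # v # xs) y"
      by (rule computes_PrecSucE)
    then obtain u where u: "computes f xs (u 0)" "\<forall>i<n. computes g (i # u i # xs) (u (Suc i))"
      "u n = v" using Suc.IH by blast
    then have "?R (u(Suc n := y))" using g by (auto simp: less_Suc_eq)
    then show "\<exists>u. ?R u" by blast
  next
    assume "\<exists>u. ?R u"
    then obtain u where u: "?R u" by blast
    then have "computes (RPrec f g) (n # xs) (u n)" unfolding Suc.IH by auto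
    then show "computes (RPrec f g) (Suc n # xs) y"
      using u by (auto intro: computes.prec_Suc)
  qed
qed

lemma computes_RPrec_Nil [simp]: "\<not> computes (RPrec f g) [] y"
  by (auto elim: computes.cases)

text \<open>A finite history is coded by two numbers, which replaces the second-order quantifier
  over \<open>u\<close> by first-order ones.\<close>

lemma computes_RPrec_beta_iff:
  "computes (RPrec f g) (n # xs) y \<longleftrightarrow> (\<exists>a b. computes f xs (beta a b 0) \<and>
     (\<forall>i<n. computes g (i # beta a b i # xs) (beta a b (Suc i))) \<and> beta a b n = y)"
  (is "_ = ?R")
proof
  assume "computes (RPrec f g) (n # xs) y"
  then obtain u where u: "computes f xs (u 0)" "\<forall>i<n. computes g (i # u i # xs) (u (Suc i))"
    "u n = y" unfolding computes_RPrec_iff by blast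
  obtain a b where ab: "\<forall>i\<le>n. beta a b i = u i" using beta_surj by blast
  have "computes f xs (beta a b 0) \<and>
     (\<forall>i<n. computes g (i # beta a b i # xs) (beta a b (Suc i))) \<and> beta a b n = y"
    using u ab by simp
  then show ?R by blast
next
  assume ?R
  then show "computes (RPrec f g) (n # xs) y" unfolding computes_RPrec_iff by blast
qed

section \<open>Arithmetic in a structure that defines its natural numbers\<close>

locale definable_nats =
  fixes A :: "'a::comm_ring_1 set"
  assumes definable_nats: "definable_pred A (\<lambda>e. e 0 \<in> \<nat>)"
    and nats_subset: "\<nat> \<subseteq> A"
    and inj_of_nat: "inj (of_nat :: nat \<Rightarrow> 'a)"
begin

definition nat_polynomial_fun :: "((nat \<Rightarrow> nat) \<Rightarrow> nat) \<Rightarrow> bool" where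
  "nat_polynomial_fun T \<longleftrightarrow>
     (\<exists>U :: (nat \<Rightarrow> 'a) \<Rightarrow> 'a. polynomial_fun U \<and> (\<forall>e. of_nat (T e) = U (\<lambda>i. of_nat (e i))))"

text \<open>\<open>Q\<close> is prescribed only at assignments by natural numbers and is arbitrary
  elsewhere.\<close>

definition arithmetical :: "((nat \<Rightarrow> nat) \<Rightarrow> bool) \<Rightarrow> bool" where
  "arithmetical P \<longleftrightarrow>
     (\<exists>Q. definable_pred A Q \<and> (\<forall>e. P e \<longleftrightarrow> Q (\<lambda>i. of_nat (e i))))"

lemma nat_polynomial_fun_var: "nat_polynomial_fun (\<lambda>e. e i)"
  unfolding nat_polynomial_fun_def by (intro exI[of _ "\<lambda>e. e i"]) (simp add: definable_intros)

lemma nat_polynomial_fun_zero: "nat_polynomial_fun (\<lambda>e. 0)"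
  unfolding nat_polynomial_fun_def by (intro exI[of _ "\<lambda>e. 0"]) (simp add: definable_intros)

lemma nat_polynomial_fun_one: "nat_polynomial_fun (\<lambda>e. 1)"
  unfolding nat_polynomial_fun_def by (intro exI[of _ "\<lambda>e. 1"]) (simp add: definable_intros)

lemma nat_polynomial_fun_add:
  assumes "nat_polynomial_fun T" "nat_polynomial_fun U"
  shows "nat_polynomial_fun (\<lambda>e. T e + U e)"
proof -
  obtain T' U' where "polynomial_fun T'" "\<forall>e. (of_nat (T e) :: 'a) = T' (\<lambda>i. of_nat (e i))"
    "polynomial_fun U'" "\<forall>e. (of_nat (U e) :: 'a) = U' (\<lambda>i. of_nat (e i))"
    using assms unfolding nat_polynomial_fun_def by blast
  then show ?thesis unfolding nat_polynomial_fun_def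
    by (intro exI[of _ "\<lambda>e. T' e + U' e"]) (simp add: polynomial_fun_add)
qed

lemma nat_polynomial_fun_mult:
  assumes "nat_polynomial_fun T" "nat_polynomial_fun U"
  shows "nat_polynomial_fun (\<lambda>e. T e * U e)"
proof -
  obtain T' U' where "polynomial_fun T'" "\<forall>e. (of_nat (T e) :: 'a) = T' (\<lambda>i. of_nat (e i))"
    "polynomial_fun U'" "\<forall>e. (of_nat (U e) :: 'a) = U' (\<lambda>i. of_nat (e i))"
    using assms unfolding nat_polynomial_fun_def by blast
  then show ?thesis unfolding nat_polynomial_fun_def
    by (intro exI[of _ "\<lambda>e. T' e * U' e"]) (simp add: polynomial_fun_mult)
qed

lemma nat_polynomial_fun_Suc:
  "nat_polynomial_fun T \<Longrightarrow> nat_polynomial_fun (\<lambda>e. Suc (T e))"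
  using nat_polynomial_fun_add[OF _ nat_polynomial_fun_one] by simp

lemma arithmetical_eq:
  assumes "nat_polynomial_fun T" "nat_polynomial_fun U"
  shows "arithmetical (\<lambda>e. T e = U e)"
proof -
  obtain T' U' where *: "polynomial_fun T'" "\<forall>e. (of_nat (T e) :: 'a) = T' (\<lambda>i. of_nat (e i))"
    "polynomial_fun U'" "\<forall>e. (of_nat (U e) :: 'a) = U' (\<lambda>i. of_nat (e i))"
    using assms unfolding nat_polynomial_fun_def by blast
  have "T e = U e \<longleftrightarrow> (of_nat (T e) :: 'a) = of_nat (U e)" for e
    using inj_of_nat by (simp add: inj_eq)
  with * show ?thesis unfolding arithmetical_def
    by (intro exI[of _ "\<lambda>e. T' e = U' e"]) (simp add: definable_pred_eq)
qed

lemma arithmetical_not: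
  assumes "arithmetical P"
  shows "arithmetical (\<lambda>e. \<not> P e)"
proof -
  obtain Q where "definable_pred A Q" "\<forall>e. P e \<longleftrightarrow> Q (\<lambda>i. of_nat (e i))"
    using assms unfolding arithmetical_def by blast
  then show ?thesis unfolding arithmetical_def
    by (intro exI[of _ "\<lambda>e. \<not> Q e"]) (simp add: definable_pred_not)
qed

lemma arithmetical_conj:
  assumes "arithmetical P" "arithmetical P'"
  shows "arithmetical (\<lambda>e. P e \<and> P' e)"
proof -
  obtain Q Q' where "definable_pred A Q" "\<forall>e. P e \<longleftrightarrow> Q (\<lambda>i. of_nat (e i))"
    "definable_pred A Q'" "\<forall>e. P' e \<longleftrightarrow> Q' (\<lambda>i. of_nat (e i))"
    using assms unfolding arithmetical_def by blast
  then show ?thesis unfolding arithmetical_def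
    by (intro exI[of _ "\<lambda>e. Q e \<and> Q' e"]) (simp add: definable_pred_conj)
qed

lemma arithmetical_imp:
  assumes "arithmetical P" "arithmetical P'"
  shows "arithmetical (\<lambda>e. P e \<longrightarrow> P' e)"
  using arithmetical_not[OF arithmetical_conj[OF assms(1) arithmetical_not[OF assms(2)]]] by simp

lemma arithmetical_subst:
  assumes "arithmetical P" "\<And>i. nat_polynomial_fun (T i)"
  shows "arithmetical (\<lambda>e. P (\<lambda>i. T i e))"
proof -
  obtain Q where Q: "definable_pred A Q" "\<And>e. P e \<longleftrightarrow> Q (\<lambda>i. of_nat (e i))"
    using assms(1) unfolding arithmetical_def by blast
  have "\<forall>i. \<exists>U :: (nat \<Rightarrow> 'a) \<Rightarrow> 'a. polynomial_fun U \<and> (\<forall>e. of_nat (T i e) = U (\<lambda>i. of_nat (e i)))"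
    using assms(2) unfolding nat_polynomial_fun_def by blast
  then obtain U :: "nat \<Rightarrow> (nat \<Rightarrow> 'a) \<Rightarrow> 'a" where
    U: "\<And>i. polynomial_fun (U i)" "\<And>i e. of_nat (T i e) = U i (\<lambda>i. of_nat (e i))"
    using choice[of "\<lambda>i (U :: (nat \<Rightarrow> 'a) \<Rightarrow> 'a). polynomial_fun U \<and> (\<forall>e. of_nat (T i e) = U (\<lambda>i. of_nat (e i)))"]
    by blast
  have "definable_pred A (\<lambda>e. Q (\<lambda>i. U i e))"
    by (rule definable_pred_subst[OF Q(1) U(1)])
  then show ?thesis unfolding arithmetical_def
    by (intro exI[of _ "\<lambda>e. Q (\<lambda>i. U i e)"]) (simp add: Q(2) U(2))
qed

text \<open>A quantifier over numbers becomes a quantifier over \<open>A\<close> relativised to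
  \<open>\<nat>\<close>, which is possible because \<open>\<nat>\<close> is definable and contained
  in \<open>A\<close>.\<close>

lemma arithmetical_ex_case_nat:
  assumes "arithmetical P"
  shows "arithmetical (\<lambda>e. \<exists>n. P (case_nat n e))"
proof -
  obtain Q where Q: "definable_pred A Q" "\<And>e. P e \<longleftrightarrow> Q (\<lambda>i. of_nat (e i))"
    using assms(1) unfolding arithmetical_def by blast
  have "definable_pred A (\<lambda>e. \<exists>a\<in>A. case_nat a e 0 \<in> \<nat> \<and> Q (case_nat a e))"
    by (rule definable_pred_bex_case_nat[OF definable_pred_conj[OF definable_nats Q(1)]])
  moreover have "(\<exists>n. P (case_nat n e)) \<longleftrightarrow>
      (\<exists>a\<in>A. case_nat a (\<lambda>i. of_nat (e i)) 0 \<in> \<nat> \<and> Q (case_nat a (\<lambda>i. of_nat (e i))))" for e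
  proof -
    have "case_nat (of_nat n) (\<lambda>i. of_nat (e i)) = (\<lambda>i. of_nat (case_nat n e i) :: 'a)" for n
      by (auto split: nat.split)
    then have "P (case_nat n e) \<longleftrightarrow> Q (case_nat (of_nat n) (\<lambda>i. of_nat (e i)))" for n
      using Q(2)[of "case_nat n e"] by simp
    moreover have "of_nat n \<in> A" for n using nats_subset by auto
    ultimately show ?thesis by (metis Nats_cases of_nat_in_Nats old.nat.simps(4))
  qed
  ultimately show ?thesis unfolding arithmetical_def by blast
qed

lemma arithmetical_ex:
  assumes "arithmetical (\<lambda>e. R (e 0) (\<lambda>i. e (Suc i)))"
  shows "arithmetical (\<lambda>e. \<exists>n. R n e)"
  using arithmetical_ex_case_nat[OF assms] by simp

lemma arithmetical_all:
  assumes "arithmetical (\<lambda>e. R (e 0) (\<lambda>i. e (Suc i)))"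
  shows "arithmetical (\<lambda>e. \<forall>n. R n e)"
  using arithmetical_not[OF arithmetical_ex[OF arithmetical_not[OF assms]]] by simp

lemma arithmetical_le:
  assumes "nat_polynomial_fun T" "nat_polynomial_fun U"
  shows "arithmetical (\<lambda>e. T e \<le> U e)"
proof -
  have "arithmetical (\<lambda>e. \<exists>k. e 1 = e 0 + k)"
    by (rule arithmetical_ex arithmetical_eq nat_polynomial_fun_add nat_polynomial_fun_var)+
  then have "arithmetical (\<lambda>e. e 0 \<le> e 1)" by (simp add: le_iff_add)
  from arithmetical_subst[OF this, of "\<lambda>i. if i = 0 then T else U"] assms show ?thesis by simp
qed

lemmas arithmetical_intros =
  nat_polynomial_fun_var nat_polynomial_fun_zero nat_polynomial_fun_one nat_polynomial_fun_add
  nat_polynomial_fun_mult nat_polynomial_fun_Suc arithmetical_eq arithmetical_not arithmetical_conj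
  arithmetical_imp arithmetical_ex arithmetical_all arithmetical_le

lemma arithmetical_beta:
  assumes "nat_polynomial_fun T" "nat_polynomial_fun U" "nat_polynomial_fun V" "nat_polynomial_fun W"
  shows "arithmetical (\<lambda>e. beta (T e) (U e) (V e) = W e)"
proof -
  have "arithmetical (\<lambda>e. beta (e 0) (e 1) (e 2) = e 3)"
    unfolding beta_eq_iff by (rule arithmetical_intros)+
  from arithmetical_subst[OF this, of "\<lambda>i. if i = 0 then T else if i = 1 then U
      else if i = 2 then V else W"] assms
  show ?thesis by simp
qed

text \<open>For fixed \<open>m\<close> a list is just \<open>m\<close> number quantifiers. The list
  entries occupy the variables below \<open>m\<close>, and the old variables move up by
  \<open>m\<close>.\<close>

lemma arithmetical_ex_list:
  assumes "arithmetical P"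
  shows "arithmetical (\<lambda>e. \<exists>ys. length ys = m \<and> P (\<lambda>i. if i < m then ys ! i else e (i - m)))"
proof (induction m)
  case 0
  then show ?case using assms by simp
next
  case (Suc m)
  have "(\<exists>ys. length ys = Suc m \<and> P (\<lambda>i. if i < Suc m then ys ! i else e (i - Suc m))) \<longleftrightarrow>
    (\<exists>y ys. length ys = m \<and> P (\<lambda>i. if i < m then ys ! i else case_nat y e (i - m)))"
    (is "?L \<longleftrightarrow> ?R") for e
  proof -
    \<comment> \<open>The new entry is put at the end of the list: index \<open>m\<close>, which is
      variable 0 of the shifted assignment, then reads \<open>y\<close>.\<close>
    have *: "(\<lambda>i. if i < Suc m then (ys @ [y]) ! i else e (i - Suc m)) =
        (\<lambda>i. if i < m then ys ! i else case_nat y e (i - m))" if "length ys = m" for y ys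
    proof
      fix i
      show "(if i < Suc m then (ys @ [y]) ! i else e (i - Suc m)) =
          (if i < m then ys ! i else case_nat y e (i - m))"
      proof (cases "i \<le> m")
        case True
        then show ?thesis using that by (auto simp: nth_append)
      next
        case False
        then obtain k where "i = Suc (m + k)" using less_imp_Suc_add by force
        then show ?thesis by simp
      qed
    qed
    show ?thesis
    proof
      assume ?L
      then obtain ys where ys: "length ys = Suc m"
        "P (\<lambda>i. if i < Suc m then ys ! i else e (i - Suc m))" by blast
      then obtain zs y where zs: "ys = zs @ [y]" "length zs = m"
        by (metis length_Suc_conv_rev)
      then show ?R using ys(2) *[OF zs(2), of y] unfolding zs(1) by (intro exI[of _ y] exI[of _ zs]) simp
    next
      assume ?R
      then obtain y ys where ys: "length ys = m"
        "P (\<lambda>i. if i < m then ys ! i else case_nat y e (i - m))" by blast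
      then show ?L using *[OF ys(1), of y] by (intro exI[of _ "ys @ [y]"]) simp
    qed
  qed
  moreover have "arithmetical (\<lambda>e. \<exists>y ys. length ys = m \<and>
      P (\<lambda>i. if i < m then ys ! i else case_nat y e (i - m)))"
    by (rule arithmetical_ex_case_nat[OF Suc.IH])
  ultimately show ?case by simp
qed

text \<open>Serves for conditions on arities such as \<open>n = 1\<close> or \<open>k < n\<close>,
  which do not depend on the assignment.\<close>

lemma arithmetical_const: "arithmetical (\<lambda>e. b)"
proof -
  have "arithmetical (\<lambda>e. (0::nat) = 0)" "arithmetical (\<lambda>e. \<not> (0::nat) = 0)"
    by (intro arithmetical_not arithmetical_eq nat_polynomial_fun_zero)+
  then show ?thesis by (cases b) simp_all
qed

lemma arithmetical_all_less:
  fixes m :: nat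
  shows "(\<And>j. j < m \<Longrightarrow> arithmetical (P j)) \<Longrightarrow> arithmetical (\<lambda>e. \<forall>j<m. P j e)"
proof (induction m)
  case 0
  show ?case using arithmetical_const[of True] by simp
next
  case (Suc m)
  have "arithmetical (\<lambda>e. P m e \<and> (\<forall>j<m. P j e))"
    by (intro arithmetical_conj Suc) simp_all
  then show ?case by (simp add: All_less_Suc)
qed

text \<open>The induction hypotheses on codes speak of consecutive variables only; this moves them
  to arbitrary polynomial arguments.\<close>

lemma arithmetical_computes_subst:
  assumes "\<And>n. arithmetical (\<lambda>e. computes c (map e [0..<n]) (e n))"
    and "\<And>T. T \<in> set Ts \<Longrightarrow> nat_polynomial_fun T" and "nat_polynomial_fun U"
  shows "arithmetical (\<lambda>e. computes c (map (\<lambda>T. T e) Ts) (U e))"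
proof -
  have "arithmetical (\<lambda>e. computes c
      (map (\<lambda>i. (if i < length Ts then Ts ! i else U) e) [0..<length Ts])
      ((if length Ts < length Ts then Ts ! length Ts else U) e))"
    by (rule arithmetical_subst[OF assms(1)]) (use assms(2,3) in auto)
  moreover have "map (\<lambda>i. (if i < length Ts then Ts ! i else U) e) [0..<length Ts] =
      map (\<lambda>T. T e) Ts" for e
    by (intro nth_equalityI) auto
  ultimately show ?thesis by simp
qed

lemma arithmetical_computes_vars:
  assumes "\<And>n. arithmetical (\<lambda>e. computes c (map e [0..<n]) (e n))" "nat_polynomial_fun U"
  shows "arithmetical (\<lambda>e. computes c (map (\<lambda>i. e (\<sigma> i)) [0..<n]) (U e))"
  using arithmetical_computes_subst[OF assms(1) _ assms(2), of "map (\<lambda>i e. e (\<sigma> i)) [0..<n]"]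
  by (fastforce simp: nat_polynomial_fun_var comp_def)

lemma arithmetical_computes_Cons:
  assumes "\<And>n. arithmetical (\<lambda>e. computes c (map e [0..<n]) (e n))"
    "nat_polynomial_fun V" "nat_polynomial_fun U"
  shows "arithmetical (\<lambda>e. computes c (V e # map (\<lambda>i. e (\<sigma> i)) [0..<n]) (U e))"
  using arithmetical_computes_subst[OF assms(1) _ assms(3), of "V # map (\<lambda>i e. e (\<sigma> i)) [0..<n]"]
    assms(2)
  by (fastforce simp: nat_polynomial_fun_var comp_def)

lemma arithmetical_computes_Cons_Cons:
  assumes "\<And>n. arithmetical (\<lambda>e. computes c (map e [0..<n]) (e n))"
    "nat_polynomial_fun V" "nat_polynomial_fun W" "nat_polynomial_fun U"
  shows "arithmetical (\<lambda>e. computes c (V e # W e # map (\<lambda>i. e (\<sigma> i)) [0..<n]) (U e))"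
  using arithmetical_computes_subst[OF assms(1) _ assms(4), of "V # W # map (\<lambda>i e. e (\<sigma> i)) [0..<n]"]
    assms(2,3)
  by (fastforce simp: nat_polynomial_fun_var comp_def)

text \<open>Induction on the code, for all arities at once because the parts of a code are applied
  to tuples of other lengths. The arguments sit in the variables below \<open>n\<close>, the value
  in variable \<open>n\<close>.\<close>

lemma arithmetical_computes: "arithmetical (\<lambda>e. computes c (map e [0..<n]) (e n))"
proof (induction c arbitrary: n)
  case RZero
  have "computes RZero xs z \<longleftrightarrow> z = 0" for xs z
    by (auto elim: computes_ZeroE intro: computes.zero)
  then show ?case by (simp add: arithmetical_intros)
next
  case RSuc
  have "computes RSuc xs z \<longleftrightarrow> (\<exists>x. xs = [x] \<and> z = Suc x)" for xs z
    by (auto elim: computes_SucE intro: computes.suc)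
  then have "computes RSuc (map e [0..<n]) (e n) \<longleftrightarrow> n = 1 \<and> e n = Suc (e 0)" for e
    by (auto simp: map_eq_Cons_conv upt_eq_Cons_conv)
  then show ?case by (simp only:) (rule arithmetical_conj arithmetical_const arithmetical_intros)+
next
  case (RProj k)
  have "computes (RProj k) xs z \<longleftrightarrow> k < length xs \<and> z = xs ! k" for xs z
    by (auto elim: computes_ProjE intro: computes.proj)
  then have "computes (RProj k) (map e [0..<n]) (e n) \<longleftrightarrow> k < n \<and> e n = e k" for e
    by auto
  then show ?case
    by (simp only:) (intro arithmetical_conj arithmetical_const arithmetical_eq nat_polynomial_fun_var)
next
  case (RComp f gs)
  let ?m = "length gs"
  \<comment> \<open>The first \<open>?m\<close> variables of \<open>d\<close> hold the values of the
    inner functions, the next \<open>n\<close> the arguments, and the one after that the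
    result.\<close>
  let ?P = "\<lambda>d. (\<forall>j<?m. computes (gs ! j) (map (\<lambda>i. d (?m + i)) [0..<n]) (d j)) \<and>
    computes f (map (\<lambda>i. d i) [0..<?m]) (d (?m + n))"
  have "arithmetical ?P"
    by (rule arithmetical_conj arithmetical_all_less arithmetical_computes_vars[OF RComp.IH(2)]
        arithmetical_computes_vars[OF RComp.IH(1)] nth_mem nat_polynomial_fun_var | assumption)+
  from arithmetical_ex_list[OF this, of ?m]
  have "arithmetical (\<lambda>e. \<exists>ys. length ys = ?m \<and> ?P (\<lambda>i. if i < ?m then ys ! i else e (i - ?m)))" .
  moreover have "computes (RComp f gs) (map e [0..<n]) (e n) \<longleftrightarrow>
      (\<exists>ys. length ys = ?m \<and> ?P (\<lambda>i. if i < ?m then ys ! i else e (i - ?m)))" for e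
  proof -
    have "map (\<lambda>i. if i < ?m then ys ! i else e (i - ?m)) [0..<?m] = ys" if "length ys = ?m" for ys
      using that by (intro nth_equalityI) auto
    then show ?thesis unfolding computes_RComp_iff by (intro ex_cong1) auto
  qed
  ultimately show ?case by simp
next
  case (RPrec f g)
  show ?case
  proof (cases n)
    case 0
    then show ?thesis using arithmetical_const[of False] by simp
  next
    case (Suc k)
    \<comment> \<open>The values of \<open>beta\<close> get names \<open>v\<close> and
      \<open>w\<close> because only equations with \<open>beta\<close> on one side are known to be
      arithmetical.\<close>
    have "arithmetical (\<lambda>e. \<exists>a b. (\<exists>v. beta a b 0 = v \<and>
          computes f (map (\<lambda>i. e (Suc i)) [0..<k]) v) \<and>
        (\<forall>i. Suc i \<le> e 0 \<longrightarrow> (\<exists>v w. beta a b i = v \<and> beta a b (Suc i) = w \<and>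
           computes g (i # v # map (\<lambda>i. e (Suc i)) [0..<k]) w)) \<and>
        beta a b (e 0) = e (Suc k))"
      by (intro arithmetical_ex arithmetical_all arithmetical_conj arithmetical_imp arithmetical_beta
          arithmetical_le arithmetical_computes_vars[OF RPrec.IH(1)]
          arithmetical_computes_Cons_Cons[OF RPrec.IH(2)]
          nat_polynomial_fun_var nat_polynomial_fun_zero nat_polynomial_fun_Suc)
    moreover have "map e [0..<Suc k] = e 0 # map (\<lambda>i. e (Suc i)) [0..<k]" for e :: "nat \<Rightarrow> nat"
      unfolding map_upt_Suc by simp
    ultimately show ?thesis
      unfolding Suc by (simp add: computes_RPrec_beta_iff Suc_le_eq del: upt_Suc)
  qed
next
  case (RMu f)
  have "arithmetical (\<lambda>e. computes f (e n # map (\<lambda>i. e i) [0..<n]) 0 \<and>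
      (\<forall>m. Suc m \<le> e n \<longrightarrow> (\<exists>k. computes f (m # map (\<lambda>i. e i) [0..<n]) (Suc k))))"
    by (intro arithmetical_ex arithmetical_all arithmetical_conj arithmetical_imp
          arithmetical_le arithmetical_computes_Cons[OF RMu.IH]
          nat_polynomial_fun_var nat_polynomial_fun_zero nat_polynomial_fun_Suc)
  then show ?case unfolding computes_RMu_iff by (simp add: Suc_le_eq)
qed

lemma definable_pred_graph:
  assumes "computable_fun f"
  shows "definable_pred A (\<lambda>e. \<exists>n. e 0 = of_nat n \<and> e 1 = of_nat (f n))"
proof -
  obtain c where c: "\<And>n. computes c [n] (f n)"
    using assms unfolding computable_fun_def by blast
  have "computes c [n] m \<longleftrightarrow> m = f n" for n m
    using c computes_deterministic by blast
  then have "arithmetical (\<lambda>e. e 1 = f (e 0))"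
    using arithmetical_computes[of c 1] by simp
  then obtain Q where Q: "definable_pred A Q" "\<And>e. e 1 = f (e 0) \<longleftrightarrow> Q (\<lambda>i. of_nat (e i))"
    unfolding arithmetical_def by blast
  \<comment> \<open>All variables but the first are identified, which turns \<open>Q\<close> into a
    binary relation. Off the natural numbers it may hold at random, so membership in
    \<open>\<nat>\<close> is added below.\<close>
  define P where "P = (\<lambda>x y. Q (\<lambda>i. if i = 0 then x else y))"
  have "definable_pred A (\<lambda>e. Q (\<lambda>i. (if i = 0 then (\<lambda>e. e 0) else (\<lambda>e. e 1)) e))"
    by (rule definable_pred_subst[OF Q(1)]) (simp add: polynomial_fun_var)
  then have P: "definable_pred A (\<lambda>e. P (e 0) (e 1))"
    unfolding P_def by (simp add: if_distrib[where f = "\<lambda>g. g _"])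
  have P_iff: "P (of_nat n) (of_nat m) \<longleftrightarrow> m = f n" for n m
  proof -
    have "(\<lambda>i. if i = 0 then of_nat n else of_nat m) =
        (\<lambda>i. of_nat (if i = (0::nat) then n else m) :: 'a)" by auto
    then show ?thesis unfolding P_def using Q(2)[of "\<lambda>i. if i = 0 then n else m"] by simp
  qed
  have "definable_pred A (\<lambda>e. e 1 \<in> \<nat>)"
    using definable_pred_subst1[OF definable_nats, of "\<lambda>e. e 1"] by (simp add: polynomial_fun_var)
  then have "definable_pred A (\<lambda>e. e 0 \<in> \<nat> \<and> e 1 \<in> \<nat> \<and> P (e 0) (e 1))"
    by (intro definable_pred_conj definable_nats P)
  moreover have "x \<in> \<nat> \<and> y \<in> \<nat> \<and> P x y \<longleftrightarrow> (\<exists>n. x = of_nat n \<and> y = of_nat (f n))" for x y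
    by (auto elim!: Nats_cases simp: P_iff)
  ultimately show ?thesis by (simp only:)
qed

end

section \<open>Two facts on real polynomials\<close>

text \<open>Over the reals the leading coefficients of fourth powers are nonnegative and so cannot
  cancel.\<close>

lemma degree_le_degree_sum_fourth_powers:
  fixes p q :: "real poly"
  assumes "degree p \<le> degree q"
  shows "4 * degree q \<le> degree (p ^ 4 + q ^ 4)"
proof (cases "q = 0")
  case False
  have "coeff (q ^ 4) (4 * degree q) = lead_coeff q ^ 4"
    using lead_coeff_power[of q 4] False by (simp add: degree_power_eq)
  moreover have "coeff (p ^ 4) (4 * degree q) \<ge> 0"
  proof (cases "degree p = degree q")
    case True
    with False show ?thesis
      using lead_coeff_power[of p 4] by (cases "p = 0") (simp_all add: degree_power_eq)
  next
    case False
    then have "degree (p ^ 4) < 4 * degree q"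
      using assms degree_power_le[of p 4] by simp
    then show ?thesis by (simp add: coeff_eq_0)
  qed
  ultimately have "coeff (p ^ 4 + q ^ 4) (4 * degree q) \<noteq> 0"
    using False by (simp add: add_nonneg_eq_0_iff)
  then show ?thesis by (rule le_degree)
qed simp

text \<open>The Mason--Stothers argument: \<open>s\<close> divides the Wronskian of \<open>p\<close> and \<open>q\<close>, whose degree is
  too small.\<close>

lemma degree_eq_0_if_sum_fourth_powers_square:
  fixes p q s :: "real poly"
  assumes "coprime p q" and s: "p ^ 4 + q ^ 4 = s ^ 2"
  shows "degree p = 0" "degree q = 0"
proof -
  define w where "w = pderiv p * q - p * pderiv q"
  \<comment> \<open>Differentiate the equation, multiply by \<open>q\<close>, and remove
    \<open>q ^ 4\<close> with the equation itself.\<close>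
  have "s * (2 * pderiv s * q - 4 * s * pderiv q) = p ^ 3 * (4 * w)"
  proof -
    have "pderiv (f ^ 4) = 4 * f ^ 3 * pderiv f" for f :: "real poly"
      by (simp add: power4_eq_xxxx power3_eq_cube pderiv_mult algebra_simps)
    moreover have "pderiv (s ^ 2) = 2 * s * pderiv s"
      by (simp add: power2_eq_square pderiv_mult algebra_simps)
    ultimately have "4 * p ^ 3 * pderiv p + 4 * q ^ 3 * pderiv q = 2 * s * pderiv s"
      using arg_cong[OF s, of pderiv] by (simp add: pderiv_add)
    then have "(4 * p ^ 3 * pderiv p + 4 * q ^ 3 * pderiv q) * q = 2 * s * pderiv s * q" by simp
    then show ?thesis using s unfolding w_def by algebra
  qed
  then have "s dvd p ^ 3 * (4 * w)" by (metis dvd_triv_left)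
  moreover have "coprime s p"
  proof (rule coprimeI)
    fix d assume "d dvd s" "d dvd p"
    then have "d dvd s ^ 2" "d dvd p ^ 4" by (simp_all add: dvd_power dvd_trans)
    then have "d dvd q ^ 4" using s by (metis dvd_add_right_iff)
    moreover have "coprime p (q ^ 4)" using assms(1) by simp
    ultimately show "is_unit d" using \<open>d dvd p\<close> coprime_common_divisor by blast
  qed
  ultimately have "s dvd 4 * w" by (simp add: coprime_dvd_mult_right_iff)
  then have "s dvd smult 4 w" by (simp add: numeral_poly)
  then have s_dvd: "s dvd w" by (simp add: dvd_smult_iff)
  define n where "n = max (degree p) (degree q)"
  \<comment> \<open>The square of \<open>s\<close> has degree at least \<open>4 * n\<close>, while
    \<open>w\<close> has degree at most \<open>2 * n - 1\<close>; so \<open>s\<close> can divide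
    \<open>w\<close> only if \<open>w = 0\<close> or \<open>n = 0\<close>.\<close>
  have deg_s: "2 * n \<le> degree s"
    using degree_le_degree_sum_fourth_powers[of p q] degree_le_degree_sum_fourth_powers[of q p]
      degree_power_le[of s 2] s unfolding n_def by (auto simp: add.commute max_def)
  have "w = 0" if "n > 0"
  proof (rule ccontr)
    assume "w \<noteq> 0"
    then have "degree s \<le> degree w" using s_dvd by (rule dvd_imp_degree_le[rotated])
    also have "degree w \<le> (n - 1) + n"
    proof -
      have "degree (pderiv p * q) \<le> (n - 1) + n"
        by (rule order.trans[OF degree_mult_le add_mono]) (auto simp: degree_pderiv n_def)
      moreover have "degree (p * pderiv q) \<le> n + (n - 1)"
        by (rule order.trans[OF degree_mult_le add_mono]) (auto simp: degree_pderiv n_def)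
      ultimately show ?thesis unfolding w_def by (simp add: degree_diff_le add.commute)
    qed
    finally show False using deg_s that by simp
  qed
  \<comment> \<open>When the Wronskian vanishes, each of the coprime polynomials divides its own
    derivative, which has smaller degree unless it is zero.\<close>
  moreover have "degree f = 0" if "coprime f g" "pderiv f * g = f * pderiv g" for f g :: "real poly"
  proof (rule ccontr)
    assume f: "degree f \<noteq> 0"
    then have "pderiv f \<noteq> 0" by (simp add: pderiv_eq_0_iff)
    moreover have "f dvd pderiv f"
      using that by (metis coprime_dvd_mult_left_iff dvd_triv_left)
    ultimately have "degree f \<le> degree (pderiv f)" by (rule dvd_imp_degree_le[rotated])
    with f show False by (simp add: degree_pderiv)
  qed
  note * = this
  ultimately have "n > 0 \<Longrightarrow> degree p = 0 \<and> degree q = 0"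
    using *[of p q] *[of q p] assms(1) unfolding w_def
    by (auto simp: algebra_simps coprime_commute)
  then have "degree p = 0 \<and> degree q = 0" unfolding n_def by fastforce
  then show "degree p = 0" "degree q = 0" by simp_all
qed

text \<open>This is \<open>1 + x ^ 4 = y ^ 2\<close> for \<open>x = p / q\<close> and
  \<open>y = s / v\<close> with denominators cleared. Dividing by \<open>v ^ 2\<close> and by the
  fourth power of the gcd reduces it to the coprime case, where both polynomials are
  constant.\<close>

lemma proportional_if_sum_fourth_powers_square:
  fixes p q s v :: "real poly"
  assumes eq: "(p ^ 4 + q ^ 4) * v ^ 2 = (s * q ^ 2) ^ 2" and "q \<noteq> 0" "v \<noteq> 0"
  shows "\<exists>c. p = smult c q"
proof -
  have "v ^ 2 dvd (s * q ^ 2) ^ 2" using eq by (metis dvd_triv_right)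
  then obtain s1 where s1: "s * q ^ 2 = v * s1" by auto
  with eq \<open>v \<noteq> 0\<close> have s1: "p ^ 4 + q ^ 4 = s1 ^ 2"
    by (simp add: power_mult_distrib)
  define g where "g = gcd p q"
  have "g \<noteq> 0" unfolding g_def using \<open>q \<noteq> 0\<close> by simp
  obtain p' q' where pq: "p = p' * g" "q = q' * g" "coprime p' q'"
    using gcd_coprime_exists[of p q] \<open>g \<noteq> 0\<close> unfolding g_def by blast
  have "s1 ^ 2 = (g ^ 2) ^ 2 * (p' ^ 4 + q' ^ 4)"
    unfolding s1[symmetric] pq by (simp add: algebra_simps power_mult_distrib)
  moreover from this have "(g ^ 2) ^ 2 dvd s1 ^ 2" by (metis dvd_triv_left)
  then have "g ^ 2 dvd s1" by (metis pow_divides_pow_iff zero_less_numeral)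
  then obtain s2 where "s1 = g ^ 2 * s2" by (rule dvdE)
  ultimately have "p' ^ 4 + q' ^ 4 = s2 ^ 2"
    using \<open>g \<noteq> 0\<close> by (simp add: power_mult_distrib)
  from degree_eq_0_if_sum_fourth_powers_square[OF pq(3) this]
  obtain a b where ab: "p' = [:a:]" "q' = [:b:]" by (metis degree_eq_zeroE)
  then have "b \<noteq> 0" using pq(2) \<open>q \<noteq> 0\<close> by auto
  then have "p = smult (a / b) q" unfolding pq ab by simp
  then show ?thesis by blast
qed

text \<open>Within distance 1/2 of \<open>c\<close> the inner factor is nonnegative, so the right
  side divided by \<open>g\<close> changes sign only through \<open>u - c\<close>. The order
  argument is carried out with signs on both sides of \<open>c\<close> and continuity.\<close>

lemma root_if_odd_times_definite:
  fixes f g w x y :: "real poly"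
  assumes eq: "f * w ^ 2 = g * ([:-c, 1:] * (x ^ 2 - (4 * [:-c, 1:] ^ 2 - 1) * y ^ 2))"
    and "w \<noteq> 0"
  shows "poly f c = 0 \<or> poly g c = 0"
proof -
  define h where "h = (\<lambda>u. (poly g u) ^ 2 * ((poly x u) ^ 2 - (4 * (u - c) ^ 2 - 1) * (poly y u) ^ 2))"
  define k where "k = order c w"
  obtain w1 where w1: "w = [:-c, 1:] ^ k * w1" "\<not> [:-c, 1:] dvd w1"
    using order_decomp[OF \<open>w \<noteq> 0\<close>, of c] unfolding k_def by blast
  \<comment> \<open>\<open>M\<close> is \<open>f * g\<close> times a square that does not vanish at
    \<open>c\<close>. Multiplying by \<open>g\<close> makes \<open>g\<close> occur squared in
    \<open>h\<close>, so that its sign is harmless.\<close>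
  define M where "M = f * g * w1 ^ 2"
  have eqM: "poly M u * (u - c) ^ (2 * k) = (u - c) * h u" for u
  proof -
    have "poly f u * (poly w u) ^ 2 = poly g u * ((u - c) *
        ((poly x u) ^ 2 - (4 * (u - c) ^ 2 - 1) * (poly y u) ^ 2))"
      using arg_cong[OF eq, of "\<lambda>p. poly p u"] by (simp add: left_diff_distrib)
    moreover have "poly w u = (u - c) ^ k * poly w1 u"
      unfolding w1(1) by simp
    ultimately have "poly f u * ((u - c) ^ (2 * k) * poly w1 u ^ 2) = poly g u * ((u - c) *
        ((poly x u) ^ 2 - (4 * (u - c) ^ 2 - 1) * (poly y u) ^ 2))"
      by (simp add: power_mult_distrib power_mult[symmetric] mult.commute[of k])
    then have "poly g u * (poly f u * ((u - c) ^ (2 * k) * poly w1 u ^ 2)) = poly g u * (poly g u * ((u - c) *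
        ((poly x u) ^ 2 - (4 * (u - c) ^ 2 - 1) * (poly y u) ^ 2)))" by simp
    then show ?thesis unfolding M_def h_def by (simp add: power2_eq_square mult_ac)
  qed
  have h_nonneg: "h u \<ge> 0" if "\<bar>u - c\<bar> \<le> 1/2" for u
  proof -
    have "(u - c) ^ 2 \<le> (1/2) ^ 2" using that abs_le_square_iff[of "u - c" "1/2"] by simp
    then have "(4 * (u - c) ^ 2 - 1) * (poly y u) ^ 2 \<le> 0"
      by (intro mult_nonpos_nonneg) (auto simp: power2_eq_square)
    then show ?thesis unfolding h_def by (intro mult_nonneg_nonneg) (auto intro: order.trans)
  qed
  \<comment> \<open>After removal of even powers of \<open>e\<close>, the values on the two sides of
    \<open>c\<close> have weakly opposite signs. As \<open>e\<close> tends to 0, the square of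
    \<open>poly M c\<close> is at most 0.\<close>
  have le: "poly M (c + e) * poly M (c - e) \<le> 0" if e: "0 < e" "e < 1/2" for e
  proof -
    have "poly M (c + e) * poly M (c - e) * (e ^ (2 * k) * e ^ (2 * k)) =
        (poly M (c + e) * e ^ (2 * k)) * (poly M (c - e) * (- e) ^ (2 * k))"
      by (simp add: mult_ac)
    also have "\<dots> = (e * h (c + e)) * (- e * h (c - e))"
      using eqM[of "c + e"] eqM[of "c - e"] by simp
    also have "\<dots> \<le> 0"
      using h_nonneg[of "c + e"] h_nonneg[of "c - e"] e by (simp add: mult_nonneg_nonneg)
    finally have "poly M (c + e) * poly M (c - e) * (e ^ (2 * k) * e ^ (2 * k)) \<le> 0" .
    moreover have "0 < e ^ (2 * k) * e ^ (2 * k)" using e by simp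
    ultimately show ?thesis by (meson mult_pos_pos not_le)
  qed
  have "((\<lambda>e. poly M (c + e) * poly M (c - e)) \<longlongrightarrow> poly M (c + 0) * poly M (c - 0)) (at_right 0)"
    by (intro tendsto_intros)
  moreover have "eventually (\<lambda>e. poly M (c + e) * poly M (c - e) \<le> 0) (at_right 0)"
    using le by (auto simp: eventually_at_right_field intro!: exI[of _ "1/2"])
  ultimately have "poly M (c + 0) * poly M (c - 0) \<le> 0"
    by (rule tendsto_upperbound) simp
  then have "poly M c = 0" by (auto simp: mult_le_0_iff)
  moreover have "poly w1 c \<noteq> 0" using w1(2) by (simp add: poly_eq_0_iff_dvd)
  ultimately show ?thesis unfolding M_def by simp
qed

section \<open>Rational functions over a Pythagorean field\<close>

locale pythagorean_function_field =
  fixes K :: "real set" and \<iota> :: "real \<Rightarrow> 'a::field" and t :: 'a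
  assumes pythagorean: "pythagorean_subfield K"
    and embedding: "field_embedding_on K \<iota>"
    and transcendental: "transcendental_over (\<iota> ` K) t"
begin

section \<open>Closure of \<open>K\<close> and the homomorphism laws of
  \<open>\<iota>\<close>\<close>

lemma K_zero: "0 \<in> K" and K_one: "1 \<in> K"
  and K_add: "x \<in> K \<Longrightarrow> y \<in> K \<Longrightarrow> x + y \<in> K"
  and K_mult: "x \<in> K \<Longrightarrow> y \<in> K \<Longrightarrow> x * y \<in> K"
  and K_uminus: "x \<in> K \<Longrightarrow> - x \<in> K"
  and K_inverse: "x \<in> K \<Longrightarrow> inverse x \<in> K"
  using pythagorean unfolding pythagorean_subfield_def is_subfield_def
  by (blast, blast, blast, blast, blast, metis inverse_zero)

lemma K_diff: "x \<in> K \<Longrightarrow> y \<in> K \<Longrightarrow> x - y \<in> K"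
  using K_add[OF _ K_uminus, of x y] by simp

lemma K_divide: "x \<in> K \<Longrightarrow> y \<in> K \<Longrightarrow> x / y \<in> K"
  by (simp add: divide_inverse K_mult K_inverse)

lemma K_power: "x \<in> K \<Longrightarrow> x ^ n \<in> K"
  by (induction n) (auto intro: K_one K_mult)

lemma K_of_nat: "of_nat n \<in> K"
  by (induction n) (auto intro: K_zero K_one K_add)

lemma K_numeral: "numeral n \<in> K"
  using K_of_nat[of "numeral n"] by simp

text \<open>The root supplied by the Pythagorean property may be the negative one; closure under
  negation gives \<open>sqrt\<close>.\<close>

lemma K_sqrt:
  assumes "x \<in> K" "0 \<le> x"
  shows "sqrt x \<in> K"
proof -
  obtain y where "y \<in> K" "x = y\<^sup>2"
    using pythagorean assms unfolding pythagorean_subfield_def by blast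
  then show ?thesis using K_uminus[of y] by (simp add: abs_if)
qed

lemmas K_intros = K_zero K_one K_add K_mult K_uminus K_inverse K_diff K_divide K_power K_of_nat
  K_numeral K_sqrt

lemma \<iota>_one: "\<iota> 1 = 1" and \<iota>_add: "x \<in> K \<Longrightarrow> y \<in> K \<Longrightarrow> \<iota> (x + y) = \<iota> x + \<iota> y"
  and \<iota>_mult: "x \<in> K \<Longrightarrow> y \<in> K \<Longrightarrow> \<iota> (x * y) = \<iota> x * \<iota> y"
  using embedding unfolding field_embedding_on_def by blast+

lemma \<iota>_zero: "\<iota> 0 = 0"
  using \<iota>_add[OF K_zero K_zero] unfolding add_0_left by (metis add_0_right add_left_cancel)

lemma \<iota>_uminus: "x \<in> K \<Longrightarrow> \<iota> (- x) = - \<iota> x"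
  using \<iota>_add[of x "- x"] by (simp add: \<iota>_zero K_uminus eq_neg_iff_add_eq_0 add.commute)

lemma \<iota>_diff: "x \<in> K \<Longrightarrow> y \<in> K \<Longrightarrow> \<iota> (x - y) = \<iota> x - \<iota> y"
  using \<iota>_add[of x "- y"] by (simp add: K_uminus \<iota>_uminus)

lemma \<iota>_of_nat: "\<iota> (of_nat n) = of_nat n"
  by (induction n) (simp_all add: \<iota>_zero \<iota>_one \<iota>_add K_one K_of_nat)

lemma \<iota>_eq_0_iff: "x \<in> K \<Longrightarrow> \<iota> x = 0 \<longleftrightarrow> x = 0"
  using \<iota>_mult[of x "inverse x"] by (cases "x = 0") (auto simp: \<iota>_zero \<iota>_one K_inverse)

lemma \<iota>_eq_iff: "x \<in> K \<Longrightarrow> y \<in> K \<Longrightarrow> \<iota> x = \<iota> y \<longleftrightarrow> x = y"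
  using \<iota>_eq_0_iff[of "x - y"] by (simp add: K_diff \<iota>_diff)

text \<open>The ambient field has characteristic zero because it contains a copy of
  \<open>K\<close>.\<close>

lemma inj_of_nat: "inj (of_nat :: nat \<Rightarrow> 'a)"
  by (rule injI) (metis K_of_nat \<iota>_eq_iff \<iota>_of_nat of_nat_eq_iff)

section \<open>The polynomial ring over \<open>K\<close> and evaluation at \<open>t\<close>\<close>

definition KX :: "real poly set" where
  "KX = {p. \<forall>i. coeff p i \<in> K}"

text \<open>The arguments are kept as real polynomials so that signs, limits and roots make sense
  for them. The homomorphism laws are available on \<open>KX\<close>, since \<open>\<iota>\<close>
  is controlled only on \<open>K\<close>.\<close>

definition ev :: "real poly \<Rightarrow> 'a" where
  "ev p = poly (map_poly \<iota> p) t"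

lemma KX_zero: "0 \<in> KX"
  by (simp add: KX_def K_zero)

lemma KX_pCons: "a \<in> K \<Longrightarrow> p \<in> KX \<Longrightarrow> pCons a p \<in> KX"
  by (auto simp: KX_def coeff_pCons split: nat.split)

lemma KX_one: "1 \<in> KX"
  by (auto simp: KX_def K_zero K_one)

lemma KX_add: "p \<in> KX \<Longrightarrow> q \<in> KX \<Longrightarrow> p + q \<in> KX"
  by (simp add: KX_def K_add)

lemma KX_uminus: "p \<in> KX \<Longrightarrow> - p \<in> KX"
  by (simp add: KX_def K_uminus)

lemma KX_diff: "p \<in> KX \<Longrightarrow> q \<in> KX \<Longrightarrow> p - q \<in> KX"
  by (simp add: KX_def K_diff)

lemma KX_smult: "a \<in> K \<Longrightarrow> p \<in> KX \<Longrightarrow> smult a p \<in> KX"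
  by (simp add: KX_def K_mult)

lemma K_sum: "(\<And>i. i \<in> I \<Longrightarrow> f i \<in> K) \<Longrightarrow> sum f I \<in> K"
  by (induction I rule: infinite_finite_induct) (auto intro: K_zero K_add)

lemma KX_mult: "p \<in> KX \<Longrightarrow> q \<in> KX \<Longrightarrow> p * q \<in> KX"
  by (auto simp: KX_def coeff_mult intro!: K_sum K_mult)

lemma KX_power: "p \<in> KX \<Longrightarrow> p ^ n \<in> KX"
  by (induction n) (auto intro: KX_one KX_mult)

lemma KX_numeral: "numeral n \<in> KX"
  by (simp add: numeral_poly KX_pCons K_numeral KX_zero)

lemma KX_prod: "(\<And>i. i \<in> I \<Longrightarrow> f i \<in> KX) \<Longrightarrow> prod f I \<in> KX"
  by (induction I rule: infinite_finite_induct) (auto intro: KX_one KX_mult)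

lemmas KX_intros = KX_zero KX_pCons KX_one KX_add KX_uminus KX_diff KX_smult KX_mult KX_power
  KX_numeral KX_prod

lemma ev_const: "ev [:a:] = \<iota> a"
  by (cases "a = 0") (simp_all add: ev_def map_poly_pCons \<iota>_zero)

lemma ev_add: "p \<in> KX \<Longrightarrow> q \<in> KX \<Longrightarrow> ev (p + q) = ev p + ev q"
proof -
  assume "p \<in> KX" "q \<in> KX"
  then have "map_poly \<iota> (p + q) = map_poly \<iota> p + map_poly \<iota> q"
    by (intro poly_eqI) (simp add: coeff_map_poly \<iota>_zero \<iota>_add KX_def)
  then show ?thesis by (simp add: ev_def)
qed

lemma ev_uminus: "p \<in> KX \<Longrightarrow> ev (- p) = - ev p"
  using ev_add[of p "- p"] ev_const[of 0]
  by (simp add: KX_uminus \<iota>_zero eq_neg_iff_add_eq_0 add.commute)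

lemma ev_diff: "p \<in> KX \<Longrightarrow> q \<in> KX \<Longrightarrow> ev (p - q) = ev p - ev q"
  using ev_add[of p "- q"] by (simp add: KX_uminus ev_uminus)

lemma ev_mult:
  assumes "p \<in> KX" "q \<in> KX"
  shows "ev (p * q) = ev p * ev q"
proof -
  have \<iota>_sum: "\<iota> (sum f I) = (\<Sum>i\<in>I. \<iota> (f i))" if "\<And>i. i \<in> I \<Longrightarrow> f i \<in> K"
    for f :: "nat \<Rightarrow> real" and I
    using that
    by (induction I rule: infinite_finite_induct) (simp_all add: \<iota>_zero \<iota>_add K_sum)
  have "map_poly \<iota> (p * q) = map_poly \<iota> p * map_poly \<iota> q"
    using assms
    by (intro poly_eqI) (simp add: coeff_map_poly \<iota>_zero \<iota>_mult K_mult KX_def coeff_mult \<iota>_sum)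
  then show ?thesis by (simp add: ev_def)
qed

lemma ev_one: "ev 1 = 1"
  using ev_const[of 1] by (simp add: \<iota>_one one_pCons)

lemma ev_numeral: "ev (numeral n) = numeral n"
  using ev_const[of "numeral n"] \<iota>_of_nat[of "numeral n"] by (simp add: numeral_poly)

lemma ev_power: "p \<in> KX \<Longrightarrow> ev (p ^ n) = ev p ^ n"
  by (induction n) (simp_all add: ev_one ev_mult KX_power)

lemma ev_linear: "a \<in> K \<Longrightarrow> ev [:-a, 1:] = t - \<iota> a"
  by (simp add: ev_def map_poly_pCons \<iota>_zero \<iota>_one \<iota>_uminus)

lemmas ev_simps = ev_add ev_uminus ev_diff ev_mult ev_one ev_numeral ev_power ev_linear

text \<open>Transcendence of \<open>t\<close> enters here: equations in the function field become
  identities between real polynomials.\<close>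

lemma ev_eq_0_iff: "p \<in> KX \<Longrightarrow> ev p = 0 \<longleftrightarrow> p = 0"
proof
  assume p: "p \<in> KX" "ev p = 0"
  then have "\<forall>i. coeff (map_poly \<iota> p) i \<in> \<iota> ` K"
    by (simp add: coeff_map_poly \<iota>_zero KX_def)
  then have "map_poly \<iota> p = 0"
    using transcendental p(2) unfolding transcendental_over_def ev_def by blast
  then have "\<iota> (coeff p i) = 0" for i
    by (metis coeff_0 coeff_map_poly \<iota>_zero)
  then show "p = 0" using p(1) by (intro poly_eqI) (simp add: \<iota>_eq_0_iff KX_def)
qed (use ev_const[of 0] in \<open>simp add: \<iota>_zero\<close>)

lemma ev_eq_iff: "p \<in> KX \<Longrightarrow> q \<in> KX \<Longrightarrow> ev p = ev q \<longleftrightarrow> p = q"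
  using ev_eq_0_iff[of "p - q"] by (simp add: KX_diff ev_diff)

section \<open>The function field as a field of fractions\<close>

abbreviation L :: "'a set" where
  "L \<equiv> field_adjoin (\<iota> ` K) t"

lemma L_zero: "0 \<in> L" and L_one: "1 \<in> L"
  and L_add: "x \<in> L \<Longrightarrow> y \<in> L \<Longrightarrow> x + y \<in> L"
  and L_mult: "x \<in> L \<Longrightarrow> y \<in> L \<Longrightarrow> x * y \<in> L"
  and L_uminus: "x \<in> L \<Longrightarrow> - x \<in> L"
  using is_subfield_field_adjoin[of "\<iota> ` K" t] unfolding is_subfield_def by blast+

lemma L_diff: "x \<in> L \<Longrightarrow> y \<in> L \<Longrightarrow> x - y \<in> L"
  using L_add[OF _ L_uminus, of x y] by simp

lemma L_t: "t \<in> L" and L_\<iota>: "a \<in> K \<Longrightarrow> \<iota> a \<in> L"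
  using subset_field_adjoin[of t "\<iota> ` K"] by auto

lemma L_of_nat: "of_nat n \<in> L"
  by (induction n) (auto intro: L_zero L_one L_add)

lemma L_ev: "p \<in> KX \<Longrightarrow> ev p \<in> L"
proof (induction p)
  case 0
  then show ?case using ev_const[of 0] L_\<iota>[OF K_zero] by simp
next
  case (pCons a p)
  then have "a \<in> K" "p \<in> KX"
    unfolding KX_def by (auto simp: coeff_pCons split: nat.splits)
  moreover have "ev (pCons a p) = \<iota> a + t * ev p"
    by (simp add: ev_def map_poly_pCons \<iota>_zero)
  ultimately show ?case using pCons by (auto intro: L_add L_mult L_t L_\<iota>)
qed

text \<open>The fractions form a subfield containing \<open>t\<close> and the image of
  \<open>K\<close>, and \<open>L\<close> is the least such subfield.\<close>

lemma L_cases: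
  assumes "x \<in> L"
  obtains p q where "p \<in> KX" "q \<in> KX" "q \<noteq> 0" "ev q \<noteq> 0" "x = ev p / ev q"
proof -
  define F where "F = {x. \<exists>p\<in>KX. \<exists>q\<in>KX. q \<noteq> 0 \<and> x = ev p / ev q}"
  have FI: "x \<in> F" if "p \<in> KX" "q \<in> KX" "q \<noteq> 0" "x = ev p / ev q" for x p q
    using that unfolding F_def by blast
  have "is_subfield F"
    unfolding is_subfield_def
  proof (intro conjI ballI impI)
    show "0 \<in> F" by (rule FI[of 0 1]) (use ev_const[of 0] in \<open>auto simp: KX_intros \<iota>_zero\<close>)
    show "1 \<in> F" by (rule FI[of 1 1]) (auto simp: KX_intros ev_simps)
    fix x assume "x \<in> F"
    then obtain p q where x: "p \<in> KX" "q \<in> KX" "q \<noteq> 0" "x = ev p / ev q"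
      unfolding F_def by blast
    then have q: "ev q \<noteq> 0" by (simp add: ev_eq_0_iff)
    show "- x \<in> F" by (rule FI[of "- p" q]) (use x in \<open>auto simp: KX_intros ev_simps\<close>)
    show "inverse x \<in> F" if "x \<noteq> 0"
      by (rule FI[of q p]) (use x that ev_const[of 0] in \<open>auto simp: \<iota>_zero\<close>)
    fix y assume "y \<in> F"
    then obtain p' q' where y: "p' \<in> KX" "q' \<in> KX" "q' \<noteq> 0" "y = ev p' / ev q'"
      unfolding F_def by blast
    then have q': "ev q' \<noteq> 0" by (simp add: ev_eq_0_iff)
    show "x + y \<in> F"
      by (rule FI[of "p * q' + p' * q" "q * q'"])
        (use x y q q' in \<open>auto simp: KX_intros ev_simps add_frac_eq\<close>)
    show "x * y \<in> F"
      by (rule FI[of "p * p'" "q * q'"]) (use x y in \<open>auto simp: KX_intros ev_simps\<close>)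
  qed
  moreover have "insert t (\<iota> ` K) \<subseteq> F"
  proof -
    have "t \<in> F"
      by (rule FI[of "[:-0, 1:]" 1]) (auto simp: KX_intros K_intros ev_one ev_linear[OF K_zero] \<iota>_zero
          simp del: minus_zero)
    moreover have "\<iota> a \<in> F" if "a \<in> K" for a
      by (rule FI[of "[:a:]" 1]) (use that in \<open>auto simp: KX_intros ev_const ev_one\<close>)
    ultimately show ?thesis by auto
  qed
  ultimately have "x \<in> F" using assms unfolding field_adjoin_def by blast
  then show thesis using that ev_eq_0_iff unfolding F_def by blast
qed

end

section \<open>Defining the constants and the natural numbers\<close>

definition constant_pred :: "'a::comm_ring_1 set \<Rightarrow> 'a \<Rightarrow> bool" where
  "constant_pred A x \<longleftrightarrow> x \<in> A \<and> (\<exists>y\<in>A. y * y = 1 + (x * x) * (x * x))"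

text \<open>The products here are arranged so that no subtraction occurs: with \<open>d = T - c\<close> the
  condition says \<open>F = \<plusminus>d (x\<^sup>2 - (4 d\<^sup>2 - 1) y\<^sup>2)\<close>.\<close>

definition odd_at_pred :: "'a::comm_ring_1 set \<Rightarrow> 'a \<Rightarrow> 'a \<Rightarrow> 'a \<Rightarrow> bool" where
  "odd_at_pred A c F T \<longleftrightarrow> (\<exists>d\<in>A. d + c = T \<and> (\<exists>x\<in>A. \<exists>y\<in>A.
     F + d * ((d + d) * (d + d) * (y * y)) = d * (x * x + y * y) \<or>
     d * ((d + d) * (d + d) * (y * y)) = d * (x * x + y * y) + F))"

text \<open>\<open>F\<close> codes the set of constants at which \<open>odd_at_pred\<close> holds.
  The case \<open>F = 0\<close> is excluded because there \<open>x = y = 0\<close> satisfies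
  \<open>odd_at_pred\<close> at every constant when \<open>T = t\<close>.\<close>

definition descent_pred :: "'a::comm_ring_1 set \<Rightarrow> 'a \<Rightarrow> 'a \<Rightarrow> bool" where
  "descent_pred A x T \<longleftrightarrow> constant_pred A x \<and> (\<exists>F\<in>A. F \<noteq> 0 \<and> odd_at_pred A x F T \<and>
     (\<forall>c\<in>A. constant_pred A c \<and> odd_at_pred A c F T \<and> c \<noteq> 0 \<longrightarrow>
       (\<exists>d\<in>A. d + 1 = c \<and> odd_at_pred A d F T)))"

definition natural_pred :: "'a::comm_ring_1 set \<Rightarrow> 'a \<Rightarrow> bool" where
  "natural_pred A x \<longleftrightarrow> x \<in> A \<and> (\<forall>T\<in>A. descent_pred A 0 T \<and>
     (\<forall>z\<in>A. descent_pred A z T \<longrightarrow> descent_pred A (z + 1) T) \<longrightarrow> descent_pred A x T)"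

definition le_pred :: "'a::comm_ring_1 set \<Rightarrow> 'a \<Rightarrow> 'a \<Rightarrow> bool" where
  "le_pred A u v \<longleftrightarrow> (\<exists>s\<in>A. constant_pred A s \<and> u + s * s = v)"

lemma definable_constant_pred [definable_intros]:
  assumes "polynomial_fun T"
  shows "definable_pred A (\<lambda>e. constant_pred A (T e))"
proof -
  have "definable_pred A (\<lambda>e. constant_pred A (e 0))"
    unfolding constant_pred_def by (rule definable_intros)+
  then show ?thesis using assms by (rule definable_pred_subst1)
qed

lemma definable_odd_at_pred [definable_intros]:
  assumes "polynomial_fun T" "polynomial_fun U" "polynomial_fun V"
  shows "definable_pred A (\<lambda>e. odd_at_pred A (T e) (U e) (V e))"
proof -
  have "definable_pred A (\<lambda>e. odd_at_pred A (e 0) (e 1) (e 2))"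
    unfolding odd_at_pred_def by (rule definable_intros)+
  then show ?thesis using assms by (rule definable_pred_subst3)
qed

lemma definable_descent_pred [definable_intros]:
  assumes "polynomial_fun T" "polynomial_fun U"
  shows "definable_pred A (\<lambda>e. descent_pred A (T e) (U e))"
proof -
  have "definable_pred A (\<lambda>e. descent_pred A (e 0) (e 1))"
    unfolding descent_pred_def by (rule definable_intros)+
  then show ?thesis using assms by (rule definable_pred_subst2)
qed

lemma definable_natural_pred: "definable_pred A (\<lambda>e. natural_pred A (e 0))"
  unfolding natural_pred_def by (rule definable_intros)+

lemma definable_le_pred [definable_intros]:
  assumes "polynomial_fun T" "polynomial_fun U"
  shows "definable_pred A (\<lambda>e. le_pred A (T e) (U e))"
proof -
  have "definable_pred A (\<lambda>e. le_pred A (e 0) (e 1))"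
    unfolding le_pred_def by (rule definable_intros)+
  then show ?thesis using assms by (rule definable_pred_subst2)
qed

section \<open>Meaning of the formulas in the function field\<close>

context pythagorean_function_field
begin

text \<open>The curve \<open>y ^ 2 = 1 + x ^ 4\<close> has genus one, so it has no nonconstant
  points in rational functions. Conversely \<open>1 + a ^ 4\<close> is positive for \<open>a\<close>
  in \<open>K\<close> and hence has a square root in \<open>K\<close>.\<close>

lemma constant_pred_iff: "constant_pred L x \<longleftrightarrow> x \<in> \<iota> ` K"
proof
  assume "constant_pred L x"
  then obtain y where "x \<in> L" "y \<in> L" and y: "y * y = 1 + (x * x) * (x * x)"
    unfolding constant_pred_def by blast
  obtain p q where pq: "p \<in> KX" "q \<in> KX" "q \<noteq> 0" "ev q \<noteq> 0" "x = ev p / ev q"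
    using L_cases[OF \<open>x \<in> L\<close>] .
  obtain s v where sv: "s \<in> KX" "v \<in> KX" "v \<noteq> 0" "ev v \<noteq> 0" "y = ev s / ev v"
    using L_cases[OF \<open>y \<in> L\<close>] .
  have xy: "x * ev q = ev p" "y * ev v = ev s" using pq(4,5) sv(4,5) by simp_all
  have "(ev p ^ 4 + ev q ^ 4) * ev v ^ 2 = (ev s * ev q ^ 2) ^ 2"
    unfolding xy[symmetric] using y by algebra
  then have "ev ((p ^ 4 + q ^ 4) * v ^ 2) = ev ((s * q ^ 2) ^ 2)"
    using pq sv by (simp add: ev_simps KX_intros)
  then have "(p ^ 4 + q ^ 4) * v ^ 2 = (s * q ^ 2) ^ 2"
    by (subst (asm) ev_eq_iff) (use pq sv in \<open>auto intro!: KX_intros\<close>)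
  from proportional_if_sum_fourth_powers_square[OF this \<open>q \<noteq> 0\<close> \<open>v \<noteq> 0\<close>]
  obtain c where c: "p = smult c q" by blast
  \<comment> \<open>So far \<open>c\<close> is only a real number; as a quotient of coefficients of
    \<open>p\<close> and \<open>q\<close> it lies in \<open>K\<close>.\<close>
  have "c = coeff p (degree q) / lead_coeff q" using c \<open>q \<noteq> 0\<close> by simp
  then have "c \<in> K" using pq(1,2) by (simp add: KX_def K_divide)
  moreover have "ev p = \<iota> c * ev q"
    using ev_mult[of "[:c:]" q] \<open>c \<in> K\<close> pq(2) by (simp add: c ev_const KX_intros)
  ultimately show "x \<in> \<iota> ` K" using pq by simp
next
  assume "x \<in> \<iota> ` K"
  then obtain a where a: "a \<in> K" "x = \<iota> a" by blast
  define b where "b = sqrt (1 + (a * a) * (a * a))"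
  have b: "b \<in> K" unfolding b_def by (intro K_intros a) simp
  have "b * b = 1 + (a * a) * (a * a)" unfolding b_def by simp
  then have "\<iota> (b * b) = \<iota> (1 + (a * a) * (a * a))" by simp
  then have "\<iota> b * \<iota> b = 1 + (x * x) * (x * x)"
    using a b by (simp add: \<iota>_mult \<iota>_add \<iota>_one K_intros)
  then show "constant_pred L x" unfolding constant_pred_def using a b by (auto intro: L_\<iota>)
qed

lemma odd_at_pred_iff:
  assumes "c \<in> L" "T \<in> L"
  shows "odd_at_pred L c F T \<longleftrightarrow> (\<exists>x\<in>L. \<exists>y\<in>L.
    F = (T - c) * (x\<^sup>2 - (4 * (T - c)\<^sup>2 - 1) * y\<^sup>2) \<or> - F = (T - c) * (x\<^sup>2 - (4 * (T - c)\<^sup>2 - 1) * y\<^sup>2))"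
proof -
  have "F + d * ((d + d) * (d + d) * (y * y)) = d * (x * x + y * y) \<longleftrightarrow>
      F = d * (x\<^sup>2 - (4 * d\<^sup>2 - 1) * y\<^sup>2)"
    "d * ((d + d) * (d + d) * (y * y)) = d * (x * x + y * y) + F \<longleftrightarrow>
      - F = d * (x\<^sup>2 - (4 * d\<^sup>2 - 1) * y\<^sup>2)" for d x y
    by algebra+
  moreover have "d + c = T \<longleftrightarrow> d = T - c" for d by (simp add: eq_diff_eq)
  moreover have "T - c \<in> L" using assms by (simp add: L_diff)
  ultimately show ?thesis unfolding odd_at_pred_def by simp
qed

text \<open>Clearing denominators leads to the real polynomial situation of
  \<open>root_if_odd_times_definite\<close>. The product \<open>f * g\<close> catches zeros as well
  as poles of the quotient, so for nonzero \<open>f\<close> only finitely many \<open>c\<close>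
  remain.\<close>

lemma odd_at_pred_root:
  assumes c: "c \<in> K" and fg: "f \<in> KX" "g \<in> KX" "ev g \<noteq> 0"
    and odd: "odd_at_pred L (\<iota> c) (ev f / ev g) t"
  shows "poly (f * g) c = 0"
proof -
  obtain x y where xy: "x \<in> L" "y \<in> L" and eq:
    "ev f / ev g = (t - \<iota> c) * (x\<^sup>2 - (4 * (t - \<iota> c)\<^sup>2 - 1) * y\<^sup>2) \<or>
     - (ev f / ev g) = (t - \<iota> c) * (x\<^sup>2 - (4 * (t - \<iota> c)\<^sup>2 - 1) * y\<^sup>2)"
    using odd odd_at_pred_iff[OF L_\<iota>[OF c] L_t] by blast
  obtain x1 u where x: "x1 \<in> KX" "u \<in> KX" "u \<noteq> 0" "ev u \<noteq> 0" "x = ev x1 / ev u"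
    using L_cases[OF xy(1)] .
  obtain y1 v where y: "y1 \<in> KX" "v \<in> KX" "v \<noteq> 0" "ev v \<noteq> 0" "y = ev y1 / ev v"
    using L_cases[OF xy(2)] .
  define w where "w = u * v"
  have w: "x * ev w = ev (x1 * v)" "y * ev w = ev (y1 * u)"
    unfolding w_def using x y by (simp_all add: ev_simps)
  let ?D = "[:-c, 1:]"
  \<comment> \<open>\<open>f'\<close> stands for \<open>f\<close> or \<open>- f\<close>, according
    to the sign in \<open>odd_at_pred\<close>.\<close>
  have *: "poly f' c = 0 \<or> poly g c = 0"
    if f': "f' \<in> KX" and eq: "ev f' / ev g = (t - \<iota> c) * (x\<^sup>2 - (4 * (t - \<iota> c)\<^sup>2 - 1) * y\<^sup>2)" for f'
  proof -
    have "ev f' = ev g * ((t - \<iota> c) * (x\<^sup>2 - (4 * (t - \<iota> c)\<^sup>2 - 1) * y\<^sup>2))"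
      using eq fg(3) by (simp add: field_simps)
    then have "ev f' * ev w ^ 2 = ev g * ((t - \<iota> c) *
        ((x * ev w)\<^sup>2 - (4 * (t - \<iota> c)\<^sup>2 - 1) * (y * ev w)\<^sup>2))" by algebra
    then have "ev f' * ev w ^ 2 = ev g * (ev ?D *
        ((ev (x1 * v))\<^sup>2 - (4 * (ev ?D)\<^sup>2 - 1) * (ev (y1 * u))\<^sup>2))"
      unfolding w by (simp add: ev_linear c)
    moreover have D: "?D \<in> KX" "w \<in> KX" "x1 * v \<in> KX" "y1 * u \<in> KX"
      using c x y unfolding w_def by (auto intro!: KX_intros K_intros)
    ultimately have "ev (f' * w ^ 2) = ev (g * (?D * ((x1 * v) ^ 2 - (4 * ?D ^ 2 - 1) * (y1 * u) ^ 2)))"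
      using f' fg by (simp only: ev_add ev_diff ev_mult ev_power ev_one ev_numeral KX_intros)
    then have "f' * w ^ 2 = g * (?D * ((x1 * v) ^ 2 - (4 * ?D ^ 2 - 1) * (y1 * u) ^ 2))"
      by (subst (asm) ev_eq_iff) (use D f' fg in \<open>auto intro!: KX_intros simp del: mult_pCons_left\<close>)
    then show ?thesis
      by (rule root_if_odd_times_definite) (use x y in \<open>auto simp: w_def\<close>)
  qed
  from eq show ?thesis
  proof
    assume "- (ev f / ev g) = (t - \<iota> c) * (x\<^sup>2 - (4 * (t - \<iota> c)\<^sup>2 - 1) * y\<^sup>2)"
    then have "ev (- f) / ev g = (t - \<iota> c) * (x\<^sup>2 - (4 * (t - \<iota> c)\<^sup>2 - 1) * y\<^sup>2)"
      using fg(1) by (simp add: ev_simps)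
    from *[OF KX_uminus[OF fg(1)] this] show ?thesis by auto
  qed (use *[OF fg(1)] in auto)
qed

text \<open>A norm form of the quadratic extension by a square root of
  \<open>4 * (X - k) ^ 2 - 1\<close>.\<close>

definition normic :: "nat \<Rightarrow> real poly \<Rightarrow> bool" where
  "normic k p \<longleftrightarrow> (\<exists>x\<in>KX. \<exists>y\<in>KX. p = x\<^sup>2 - (4 * [:- of_nat k, 1:]\<^sup>2 - 1) * y\<^sup>2)"

text \<open>Brahmagupta's identity for the form \<open>x ^ 2 - d * y ^ 2\<close>.\<close>

lemma normic_mult:
  assumes "normic k p" "normic k q"
  shows "normic k (p * q)"
proof -
  define d :: "real poly" where "d = 4 * [:- of_nat k, 1:]\<^sup>2 - 1"
  have d: "d \<in> KX" unfolding d_def by (intro KX_intros K_intros)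
  obtain x y x' y' where "x \<in> KX" "y \<in> KX" "p = x\<^sup>2 - d * y\<^sup>2" "x' \<in> KX" "y' \<in> KX" "q = x'\<^sup>2 - d * y'\<^sup>2"
    using assms unfolding normic_def d_def by blast
  moreover from this have "p * q = (x * x' + d * y * y')\<^sup>2 - d * (x * y' + x' * y)\<^sup>2" by algebra
  ultimately show ?thesis unfolding normic_def d_def[symmetric] using d
    by (blast intro: KX_intros)
qed

lemma normic_pm_prod:
  assumes "finite I" "\<And>i. i \<in> I \<Longrightarrow> normic k (f i) \<or> normic k (- f i)"
  shows "normic k (prod f I) \<or> normic k (- prod f I)"
  using assms
proof (induction I)
  case empty
  have "normic k 1" unfolding normic_def
    by (intro bexI[of _ 1] bexI[of _ 0] KX_intros) simp
  then show ?case by simp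
next
  case (insert i I)
  then show ?case
    using normic_mult[of k "f i" "prod f I"] normic_mult[of k "- f i" "prod f I"]
      normic_mult[of k "f i" "- prod f I"] normic_mult[of k "- f i" "- prod f I"]
    by auto
qed

text \<open>A linear polynomial \<open>t - j\<close> is \<open>\<plusminus>((b (t - k) + e)\<^sup>2 - (4 (t - k)\<^sup>2 - 1) (b / 2)\<^sup>2)\<close>
  as soon as \<open>2 b e = \<plusminus>1\<close> and \<open>e\<^sup>2 + b\<^sup>2 / 4 = \<bar>k - j\<bar>\<close>.\<close>

lemma normic_linear:
  assumes "j \<noteq> k"
  shows "normic k [:- of_nat j, 1:] \<or> normic k (- [:- of_nat j, 1:])"
proof -
  define m :: real where "m = \<bar>of_nat k - of_nat j\<bar>"
  have m: "m \<ge> 1" unfolding m_def using assms by linarith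
  have mK: "m \<in> K" unfolding m_def abs_if by (auto intro!: K_intros)
  \<comment> \<open>With \<open>e = \<sigma> / (2 * b)\<close> the condition
    \<open>e ^ 2 + b ^ 2 / 4 = m\<close> reads \<open>b ^ 4 - 4 * m * b ^ 2 + 1 = 0\<close>. This is
    its larger solution for \<open>b ^ 2\<close>; both nested roots exist in \<open>K\<close>
    because \<open>m\<close> is at least 1.\<close>
  define b where "b = sqrt (2 * m + sqrt (4 * m\<^sup>2 - 1))"
  have "1 \<le> m\<^sup>2" using m by (simp add: one_le_power)
  then have r: "0 \<le> 4 * m\<^sup>2 - 1" by simp
  then have b2: "b\<^sup>2 = 2 * m + sqrt (4 * m\<^sup>2 - 1)" and b_pos: "b > 0"
    unfolding b_def using m by (simp_all add: add_pos_nonneg)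
  have bK: "b \<in> K" unfolding b_def using m r by (intro K_intros mK add_nonneg_nonneg) auto
  have "(b\<^sup>2 - 2 * m)\<^sup>2 = 4 * m\<^sup>2 - 1" unfolding b2 using r by simp
  then have "b\<^sup>2 * b\<^sup>2 + 1 = 4 * m * b\<^sup>2" by algebra
  then have m_eq: "m = 1 / (4 * b\<^sup>2) + b\<^sup>2 / 4" using b_pos by (simp add: field_simps power2_eq_square)
  have "normic k (smult \<sigma> [:- of_nat k, 1:] + [:m:])" if \<sigma>: "\<sigma> = 1 \<or> \<sigma> = -1" for \<sigma> :: real
  proof -
    define e where "e = \<sigma> / (2 * b)"
    have "\<sigma> * \<sigma> = 1" using \<sigma> by auto
    then have e: "2 * b * e = \<sigma>" "e\<^sup>2 + b\<^sup>2 / 4 = m"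
      unfolding e_def m_eq using b_pos by (simp_all add: power2_eq_square)
    have eK: "e \<in> K" unfolding e_def using \<sigma> bK by (auto intro!: K_intros)
    have "smult \<sigma> [:- of_nat k, 1:] + [:m:] = (smult b [:- of_nat k, 1:] + [:e:])\<^sup>2 -
        (4 * [:- of_nat k, 1:]\<^sup>2 - 1) * [:b / 2:]\<^sup>2"
    proof (rule poly_ext)
      fix u :: real
      have "\<sigma> * (u - of_nat k) + m = (b * (u - of_nat k) + e)\<^sup>2 - (4 * (u - of_nat k)\<^sup>2 - 1) * (b / 2)\<^sup>2"
        unfolding e(1)[symmetric] e(2)[symmetric] by (simp add: power2_eq_square field_simps)
      then show "poly (smult \<sigma> [:- of_nat k, 1:] + [:m:]) u = poly ((smult b [:- of_nat k, 1:] + [:e:])\<^sup>2 -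
        (4 * [:- of_nat k, 1:]\<^sup>2 - 1) * [:b / 2:]\<^sup>2) u"
        by (simp add: algebra_simps)
    qed
    then show ?thesis unfolding normic_def
      by (intro bexI) (auto intro!: KX_intros K_intros bK eK)
  qed
  \<comment> \<open>For \<open>j < k\<close> the sign 1 yields \<open>X - j\<close>; for
    \<open>k < j\<close> the sign -1 yields its negative.\<close>
  from this[of 1] this[of "-1"] show ?thesis
    unfolding m_def by (cases "k < j") auto
qed

text \<open>The factor with index \<open>k\<close> is the required \<open>t - k\<close>, and the
  product of the others is a norm up to sign.\<close>

lemma odd_at_pred_prod:
  fixes n k :: nat
  assumes "k \<le> n"
  shows "odd_at_pred L (of_nat k) (ev (\<Prod>j\<le>n. [:- of_nat j, 1:])) t"
proof -
  let ?f = "\<lambda>j :: nat. [:- of_nat j, 1:] :: real poly"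
  let ?P = "prod ?f ({..n} - {k})"
  have P: "prod ?f {..n} = ?f k * ?P" using assms by (simp add: prod.remove)
  have fK: "?f j \<in> KX" "?P \<in> KX" for j by (intro KX_intros K_intros)+
  have ev_f: "ev (?f k) = t - of_nat k" by (simp only: ev_linear K_of_nat \<iota>_of_nat)
  have *: "\<exists>x\<in>L. \<exists>y\<in>L. ev (?f k * q) = (t - of_nat k) * (x\<^sup>2 - (4 * (t - of_nat k)\<^sup>2 - 1) * y\<^sup>2)"
    if q: "normic k q" for q
  proof -
    obtain x y where xy: "x \<in> KX" "y \<in> KX" "q = x\<^sup>2 - (4 * (?f k)\<^sup>2 - 1) * y\<^sup>2"
      using q unfolding normic_def by blast
    have "ev (?f k * q) = (t - of_nat k) * ((ev x)\<^sup>2 - (4 * (t - of_nat k)\<^sup>2 - 1) * (ev y)\<^sup>2)"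
      unfolding xy(3)
      by (simp only: ev_add ev_diff ev_mult ev_power ev_one ev_numeral KX_add KX_diff KX_mult
          KX_power KX_one KX_numeral fK xy ev_f)
    then show ?thesis using L_ev xy by blast
  qed
  have "normic k ?P \<or> normic k (- ?P)"
    by (rule normic_pm_prod[OF _ normic_linear]) auto
  then have "\<exists>x\<in>L. \<exists>y\<in>L. ev (prod ?f {..n}) = (t - of_nat k) * (x\<^sup>2 - (4 * (t - of_nat k)\<^sup>2 - 1) * y\<^sup>2) \<or>
      - ev (prod ?f {..n}) = (t - of_nat k) * (x\<^sup>2 - (4 * (t - of_nat k)\<^sup>2 - 1) * y\<^sup>2)"
  proof
    assume "normic k ?P"
    from *[OF this] show ?thesis unfolding P by blast
  next
    assume "normic k (- ?P)"
    moreover have "ev (?f k * (- ?P)) = - ev (?f k * ?P)"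
      by (simp only: ev_mult ev_uminus KX_mult fK mult_minus_right)
    ultimately show ?thesis using *[of "- ?P"] unfolding P by metis
  qed
  then show ?thesis by (subst odd_at_pred_iff) (auto intro: L_of_nat L_t)
qed

text \<open>If \<open>x\<close> were not natural, the descent would never stop at 0, and all
  \<open>x - n\<close> would give roots of one nonzero polynomial. For \<open>x = n\<close> the
  witness is \<open>t (t - 1) ... (t - n)\<close>.\<close>

lemma descent_pred_iff: "descent_pred L x t \<longleftrightarrow> x \<in> \<nat>"
proof
  assume "descent_pred L x t"
  then obtain F where x: "constant_pred L x" and "F \<in> L" "F \<noteq> 0" and Fx: "odd_at_pred L x F t" and
    F: "\<And>c. constant_pred L c \<Longrightarrow> odd_at_pred L c F t \<Longrightarrow> c \<noteq> 0 \<Longrightarrow>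
       (\<exists>d\<in>L. d + 1 = c \<and> odd_at_pred L d F t)"
    unfolding descent_pred_def by (metis constant_pred_def)
  obtain f g where fg: "f \<in> KX" "g \<in> KX" "g \<noteq> 0" "ev g \<noteq> 0" "F = ev f / ev g"
    using L_cases[OF \<open>F \<in> L\<close>] .
  have "f \<noteq> 0" using \<open>F \<noteq> 0\<close> fg ev_eq_0_iff[of f] by auto
  obtain a where a: "a \<in> K" "x = \<iota> a" using x constant_pred_iff by auto
  show "x \<in> \<nat>"
  proof (rule ccontr)
    assume "x \<notin> \<nat>"
    then have ne: "a \<noteq> of_nat n" for n using a \<iota>_of_nat by auto
    have "odd_at_pred L (\<iota> (a - of_nat n)) F t" for n
    proof (induction n)
      case 0
      then show ?case using Fx a by simp
    next
      case (Suc n)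
      have K: "a - of_nat n \<in> K" "a - of_nat (Suc n) \<in> K" using a by (auto intro: K_intros)
      have "\<iota> (a - of_nat n) \<noteq> 0" using ne[of n] K by (simp add: \<iota>_eq_0_iff)
      then obtain d where "d + 1 = \<iota> (a - of_nat n)" "odd_at_pred L d F t"
        using F[OF _ Suc] K constant_pred_iff by blast
      moreover have "\<iota> (a - of_nat n) = \<iota> (a - of_nat (Suc n)) + 1"
        using \<iota>_add[OF K(2) K_one] by (simp add: \<iota>_one)
      ultimately show ?case by simp
    qed
    then have "poly (f * g) (a - of_nat n) = 0" for n
      using odd_at_pred_root fg a by (blast intro: K_intros)
    then have "range (\<lambda>n. a - of_nat n) \<subseteq> {z. poly (f * g) z = 0}" by auto
    moreover have "finite {z. poly (f * g) z = 0}"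
      using \<open>f \<noteq> 0\<close> \<open>g \<noteq> 0\<close> by (intro poly_roots_finite) simp
    ultimately have "finite (range (\<lambda>n. a - real n))" using finite_subset by blast
    then show False using finite_imageD[of "\<lambda>n. a - real n" UNIV] by (auto simp: inj_on_def)
  qed
next
  assume "x \<in> \<nat>"
  then obtain n where n: "x = of_nat n" by (auto elim: Nats_cases)
  let ?f = "\<Prod>j\<le>n. [:- of_nat j, 1:] :: real poly"
  have fK: "?f \<in> KX" by (intro KX_intros K_intros)
  have const: "constant_pred L (of_nat m)" for m
    using constant_pred_iff K_of_nat \<iota>_of_nat by (metis image_eqI)
  have "\<exists>d\<in>L. d + 1 = c \<and> odd_at_pred L d (ev ?f) t"
    if c: "constant_pred L c" "odd_at_pred L c (ev ?f) t" "c \<noteq> 0" for c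
  proof -
    obtain b where b: "b \<in> K" "c = \<iota> b" using c(1) constant_pred_iff by auto
    \<comment> \<open>With denominator 1, the only candidates for \<open>b\<close> are the roots
      \<open>0, ..., n\<close> of the product.\<close>
    have "poly (?f * 1) b = 0"
      by (rule odd_at_pred_root) (use b c(2) fK in \<open>auto simp: ev_one intro: KX_one\<close>)
    then obtain j where j: "j \<le> n" "b = of_nat j"
      by (auto simp: poly_prod)
    then have "j \<noteq> 0" using b c(3) \<iota>_zero by (metis of_nat_0)
    then obtain i where "j = Suc i" by (cases j) auto
    then have "of_nat i + 1 = c" "i \<le> n" using b(2) j \<iota>_of_nat[of "Suc i"] by (auto simp: add.commute)
    then show ?thesis using odd_at_pred_prod[of i n] L_of_nat by blast
  qed
  moreover have "ev ?f \<noteq> 0" using fK by (simp add: ev_eq_0_iff)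
  moreover have "odd_at_pred L (of_nat n) (ev ?f) t" by (rule odd_at_pred_prod) simp
  ultimately show "descent_pred L x t" unfolding descent_pred_def n using const L_ev[OF fK] by blast
qed

lemma natural_pred_iff: "natural_pred L x \<longleftrightarrow> x \<in> \<nat>"
proof
  assume "natural_pred L x"
  moreover have "descent_pred L 0 t \<and> (\<forall>z\<in>L. descent_pred L z t \<longrightarrow> descent_pred L (z + 1) t)"
    unfolding descent_pred_iff by (auto intro: Nats_add)
  ultimately have "descent_pred L x t"
    unfolding natural_pred_def using L_t by blast
  then show "x \<in> \<nat>" by (simp add: descent_pred_iff)
next
  assume "x \<in> \<nat>"
  then obtain n where n: "x = of_nat n" by (auto elim: Nats_cases)
  have "descent_pred L (of_nat n) T"
    if "descent_pred L 0 T" "\<forall>z\<in>L. descent_pred L z T \<longrightarrow> descent_pred L (z + 1) T" for T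
    using that by (induction n) (auto simp: L_of_nat add.commute)
  then show "natural_pred L x" unfolding natural_pred_def n by (simp add: L_of_nat)
qed

sublocale definable_nats L
proof
  show "definable_pred L (\<lambda>e. e 0 \<in> \<nat>)"
    using definable_natural_pred[of L] by (simp add: natural_pred_iff)
  show "\<nat> \<subseteq> L" by (auto elim!: Nats_cases intro: L_of_nat)
qed (rule inj_of_nat)

text \<open>The nonnegative elements of \<open>K\<close> are the squares of elements of
  \<open>K\<close>, so the real order can be read off the field structure.\<close>

lemma le_pred_iff:
  assumes "a \<in> K" "b \<in> K"
  shows "le_pred L (\<iota> a) (\<iota> b) \<longleftrightarrow> a \<le> b"
proof
  assume "le_pred L (\<iota> a) (\<iota> b)"
  then obtain s where s: "s \<in> K" "\<iota> a + \<iota> s * \<iota> s = \<iota> b"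
    unfolding le_pred_def constant_pred_iff by auto
  then have "\<iota> (a + s * s) = \<iota> b" using assms by (simp add: \<iota>_add \<iota>_mult K_intros)
  then have "a + s * s = b" using assms s by (simp add: \<iota>_eq_iff K_intros)
  then show "a \<le> b" by (metis le_add_same_cancel1 zero_le_square)
next
  assume "a \<le> b"
  define s where "s = sqrt (b - a)"
  have s: "s \<in> K" "a + s * s = b" unfolding s_def using \<open>a \<le> b\<close> assms by (auto intro!: K_intros)
  then have "\<iota> a + \<iota> s * \<iota> s = \<iota> b" using assms by (simp flip: \<iota>_add \<iota>_mult add: K_intros)
  then show "le_pred L (\<iota> a) (\<iota> b)"
    unfolding le_pred_def constant_pred_iff using s by (auto intro: L_\<iota>)
qed

end

section \<open>Defining limits of computable sequences\<close>

definition graph_pred :: "(nat \<Rightarrow> nat) \<Rightarrow> 'a::comm_ring_1 \<Rightarrow> 'a \<Rightarrow> bool" where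
  "graph_pred f u v \<longleftrightarrow> (\<exists>n. u = of_nat n \<and> v = of_nat (f n))"

text \<open>The inequality \<open>\<bar>x - (-1) ^ s * a / b\<bar> \<le> 1 / (k + 1)\<close>
  multiplied by \<open>b * (k + 1)\<close>. Parity of \<open>s\<close> decides the sign, and terms
  are moved across so that no subtraction or division occurs.\<close>

definition close_pred :: "'a::comm_ring_1 set \<Rightarrow> 'a \<Rightarrow> 'a \<Rightarrow> 'a \<Rightarrow> 'a \<Rightarrow> 'a \<Rightarrow> bool" where
  "close_pred A k s a b x \<longleftrightarrow>
     (\<exists>h\<in>A. h \<in> \<nat> \<and> s = h + h \<and>
       le_pred A ((k + 1) * (b * x)) (b + (k + 1) * a) \<and>
       le_pred A ((k + 1) * a) (b + (k + 1) * (b * x))) \<or>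
     (\<exists>h\<in>A. h \<in> \<nat> \<and> s = h + h + 1 \<and>
       le_pred A ((k + 1) * (b * x + a)) b \<and> le_pred A 0 (b + (k + 1) * (b * x + a)))"

text \<open>Indices beyond \<open>M\<close> are written \<open>M + m\<close>, so that no comparison
  of indices is needed.\<close>

definition limit_pred ::
    "'a::comm_ring_1 set \<Rightarrow> (nat \<Rightarrow> nat) \<Rightarrow> (nat \<Rightarrow> nat) \<Rightarrow> (nat \<Rightarrow> nat) \<Rightarrow> 'a \<Rightarrow> bool" where
  "limit_pred A fs fa fb x \<longleftrightarrow> constant_pred A x \<and>
     (\<forall>k\<in>A. k \<in> \<nat> \<longrightarrow> (\<exists>M\<in>A. M \<in> \<nat> \<and> (\<forall>m\<in>A. m \<in> \<nat> \<longrightarrow>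
       (\<exists>s\<in>A. \<exists>a\<in>A. \<exists>b\<in>A. graph_pred fs (M + m) s \<and> graph_pred fa (M + m) a \<and>
          graph_pred fb (M + m) b \<and> close_pred A k s a b x))))"

section \<open>Correctness of the limit formula\<close>

context pythagorean_function_field
begin

lemma definable_limit_pred:
  assumes "computable_fun fs" "computable_fun fa" "computable_fun fb"
  shows "definable_pred L (\<lambda>e. limit_pred L fs fa fb (e 0))"
proof -
  have nats: "definable_pred L (\<lambda>e. T e \<in> \<nat>)" if "polynomial_fun T" for T
    using definable_nats that by (rule definable_pred_subst1)
  have graph: "definable_pred L (\<lambda>e. graph_pred f (T e) (U e))"
    if "computable_fun f" "polynomial_fun T" "polynomial_fun U" for f T U
  proof -
    have "definable_pred L (\<lambda>e. graph_pred f (e 0) (e 1))"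
      unfolding graph_pred_def by (rule definable_pred_graph[OF that(1)])
    then show ?thesis using that(2,3) by (rule definable_pred_subst2)
  qed
  show ?thesis unfolding limit_pred_def close_pred_def
    by (rule nats graph[OF assms(1)] graph[OF assms(2)] graph[OF assms(3)] definable_intros)+
qed

lemma bex_nats_iff: "(\<exists>h\<in>L. h \<in> \<nat> \<and> P h) \<longleftrightarrow> (\<exists>n. P (of_nat n))"
  by (metis L_of_nat Nats_cases of_nat_in_Nats)

lemma ball_nats_iff: "(\<forall>h\<in>L. h \<in> \<nat> \<longrightarrow> P h) \<longleftrightarrow> (\<forall>n. P (of_nat n))"
  by (metis L_of_nat Nats_cases of_nat_in_Nats)

lemma close_pred_iff:
  assumes y: "y \<in> K" and b: "b > 0"
  shows "close_pred L (of_nat k) (of_nat s) (of_nat a) (of_nat b) (\<iota> y) \<longleftrightarrow>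
    \<bar>y - (- 1) ^ s * of_nat a / of_nat b\<bar> * (of_nat k + 1) \<le> 1"
proof -
  have nat_eq: "of_nat s = (of_nat n :: 'a) + of_nat n \<longleftrightarrow> s = n + n"
    "of_nat s = (of_nat n :: 'a) + of_nat n + 1 \<longleftrightarrow> s = n + n + 1" for n
    using inj_eq[OF inj_of_nat, of s "n + n"] inj_eq[OF inj_of_nat, of s "n + n + 1"]
    by (simp_all only: of_nat_add of_nat_1)
  let ?q = "(- 1) ^ s * of_nat a / of_nat b :: real"
  let ?E = "(of_nat k + 1) * (of_nat b * y - (- 1) ^ s * of_nat a) :: real"
  \<comment> \<open>Multiplying by the positive denominator \<open>b\<close> leaves a comparison of
    elements of \<open>K\<close> formed by ring operations alone.\<close>
  have "\<bar>(y - ?q) * of_nat b * (of_nat k + 1)\<bar> = \<bar>y - ?q\<bar> * (of_nat k + 1) * of_nat b"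
    by (simp add: abs_mult)
  then have "\<bar>y - ?q\<bar> * (of_nat k + 1) \<le> 1 \<longleftrightarrow> \<bar>(y - ?q) * of_nat b * (of_nat k + 1)\<bar> \<le> of_nat b"
    using b by (simp only: mult_le_cancel_right2) simp
  also have "(y - ?q) * of_nat b * (of_nat k + 1) = ?E"
    using b by (simp add: field_simps)
  finally have *: "\<bar>y - ?q\<bar> * (of_nat k + 1) \<le> 1 \<longleftrightarrow> ?E \<le> of_nat b \<and> 0 \<le> of_nat b + ?E"
    by (auto simp: abs_le_iff)
  let ?u = "(of_nat k + 1) * (of_nat b * y) :: real" and ?v = "(of_nat k + 1) * of_nat a :: real"
    and ?w = "(of_nat k + 1) * (of_nat b * y + of_nat a) :: real"
  have le: "le_pred L ((of_nat k + 1) * (of_nat b * \<iota> y)) (of_nat b + (of_nat k + 1) * of_nat a) \<longleftrightarrow>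
      ?u \<le> of_nat b + ?v"
    "le_pred L ((of_nat k + 1) * of_nat a) (of_nat b + (of_nat k + 1) * (of_nat b * \<iota> y)) \<longleftrightarrow>
      ?v \<le> of_nat b + ?u"
    "le_pred L ((of_nat k + 1) * (of_nat b * \<iota> y + of_nat a)) (of_nat b) \<longleftrightarrow> ?w \<le> of_nat b"
    "le_pred L 0 (of_nat b + (of_nat k + 1) * (of_nat b * \<iota> y + of_nat a)) \<longleftrightarrow> 0 \<le> of_nat b + ?w"
    using le_pred_iff[of ?u "of_nat b + ?v"] le_pred_iff[of ?v "of_nat b + ?u"]
      le_pred_iff[of ?w "of_nat b"] le_pred_iff[of 0 "of_nat b + ?w"] y
    by (simp_all add: \<iota>_add \<iota>_mult \<iota>_of_nat \<iota>_one \<iota>_zero K_intros)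
  have "close_pred L (of_nat k) (of_nat s) (of_nat a) (of_nat b) (\<iota> y) \<longleftrightarrow>
     (\<exists>n. s = n + n \<and> (of_nat k + 1) * (of_nat b * y) \<le> of_nat b + (of_nat k + 1) * of_nat a \<and>
       (of_nat k + 1) * of_nat a \<le> of_nat b + (of_nat k + 1) * (of_nat b * y)) \<or>
     (\<exists>n. s = n + n + 1 \<and> (of_nat k + 1) * (of_nat b * y + of_nat a) \<le> of_nat b \<and>
       0 \<le> of_nat b + (of_nat k + 1) * (of_nat b * y + of_nat a))"
    unfolding close_pred_def le bex_nats_iff nat_eq ..
  also have "\<dots> \<longleftrightarrow> ?E \<le> of_nat b \<and> 0 \<le> of_nat b + ?E"
  proof (cases "even s")
    case True
    then obtain n where "s = n + n" by (metis evenE mult_2)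
    moreover have "s \<noteq> m + m + 1" for m using True by presburger
    ultimately show ?thesis by (auto simp: algebra_simps)
  next
    case False
    then obtain n where "s = n + n + 1" by (metis oddE mult_2)
    moreover have "s \<noteq> m + m" for m using False by presburger
    ultimately show ?thesis by (auto simp: algebra_simps)
  qed
  finally show ?thesis using * by simp
qed

text \<open>A constant satisfying the formula is within \<open>1 / (k + 1)\<close> of all late terms
  for every \<open>k\<close>. In the limit it has distance 0 from \<open>r\<close>.\<close>

lemma limit_pred_iff:
  assumes q: "\<And>n. fb n \<noteq> 0" "\<And>n. q n = (- 1) ^ fs n * of_nat (fa n) / of_nat (fb n)"
    and lim: "q \<longlonglongrightarrow> (r :: real)" and r: "r \<in> K"
  shows "limit_pred L fs fa fb x \<longleftrightarrow> x = \<iota> r"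
proof -
  have inj: "of_nat m = (of_nat n :: 'a) \<longleftrightarrow> m = n" for m n
    using inj_of_nat by (simp add: inj_eq)
  have graph: "graph_pred f (of_nat M + of_nat m) v \<longleftrightarrow> v = of_nat (f (M + m))"
    for f M m and v :: 'a
    unfolding graph_pred_def of_nat_add[symmetric] inj by auto
  have iff: "limit_pred L fs fa fb (\<iota> y) \<longleftrightarrow>
      (\<forall>k. \<exists>M. \<forall>m. \<bar>y - q (M + m)\<bar> * (of_nat k + 1) \<le> 1)" if y: "y \<in> K" for y
  proof -
    have "limit_pred L fs fa fb (\<iota> y) \<longleftrightarrow> (\<forall>k. \<exists>M. \<forall>m. close_pred L (of_nat k) (of_nat (fs (M + m)))
        (of_nat (fa (M + m))) (of_nat (fb (M + m))) (\<iota> y))"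
      unfolding limit_pred_def bex_nats_iff ball_nats_iff graph using y by (simp add: constant_pred_iff L_of_nat)
    also have "\<dots> \<longleftrightarrow> (\<forall>k. \<exists>M. \<forall>m. \<bar>y - q (M + m)\<bar> * (of_nat k + 1) \<le> 1)"
      using q y by (simp add: close_pred_iff)
    finally show ?thesis .
  qed
  have "limit_pred L fs fa fb (\<iota> r)"
    unfolding iff[OF r]
  proof
    fix k :: nat
    have "0 < 1 / (of_nat k + 1 :: real)" by simp
    from LIMSEQ_D[OF lim this] obtain M where M: "\<And>n. n \<ge> M \<Longrightarrow> \<bar>q n - r\<bar> < 1 / (of_nat k + 1)"
      by auto
    have "\<bar>r - q (M + m)\<bar> * (of_nat k + 1) \<le> 1" for m
      using M[of "M + m"] by (simp add: field_simps abs_minus_commute)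
    then show "\<exists>M. \<forall>m. \<bar>r - q (M + m)\<bar> * (of_nat k + 1) \<le> 1" by blast
  qed
  moreover have "x = \<iota> r" if limit: "limit_pred L fs fa fb x"
  proof -
    obtain y where y: "y \<in> K" "x = \<iota> y"
      using limit constant_pred_iff unfolding limit_pred_def by auto
    have le: "\<bar>y - r\<bar> \<le> 1 / real (Suc k)" for k
    proof -
      obtain M where M: "\<And>m. \<bar>y - q (M + m)\<bar> * (of_nat k + 1) \<le> 1"
        using limit iff[OF y(1)] y(2) by blast
      have "(\<lambda>m. \<bar>y - q (m + M)\<bar>) \<longlonglongrightarrow> \<bar>y - r\<bar>"
        by (intro tendsto_intros LIMSEQ_ignore_initial_segment lim)
      moreover have "\<bar>y - q (m + M)\<bar> \<le> 1 / real (Suc k)" for m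
        using M[of m] by (simp add: field_simps)
      ultimately show ?thesis by (intro LIMSEQ_le_const2) auto
    qed
    have "\<bar>y - r\<bar> \<le> 0"
      by (rule LIMSEQ_le_const[OF lim_1_over_n[THEN LIMSEQ_Suc]]) (use le in auto)
    then show ?thesis using y by simp
  qed
  ultimately show ?thesis by auto
qed

end

theorem theorem6:
  fixes K :: "real set" and \<iota> :: "real \<Rightarrow> 'a::field" and t :: 'a and r :: real
  assumes "pythagorean_subfield K"
    and "field_embedding_on K \<iota>"
    and "transcendental_over (\<iota> ` K) t"
    and "r \<in> K"
    and "recursively_approximable r"
  shows "empty_definable (field_adjoin (\<iota> ` K) t) {\<iota> r}"
proof -
  interpret pythagorean_function_field K \<iota> t
    by unfold_locales (use assms in auto)
  obtain q fs fa fb where comp: "computable_fun fs" "computable_fun fa" "computable_fun fb"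
    and q: "\<And>n. fb n \<noteq> 0" "\<And>n. q n = (- 1) ^ fs n * of_nat (fa n) / of_nat (fb n)"
    and lim: "(\<lambda>n. real_of_rat (q n)) \<longlonglongrightarrow> r"
    using assms(5) unfolding recursively_approximable_def computable_rat_seq_def by blast
  \<comment> \<open>The sequence is rational; the lemma is applied to its image in the reals, where
    sign, numerator and denominator are unchanged.\<close>
  have "limit_pred L fs fa fb x \<longleftrightarrow> x = \<iota> r" for x
    by (rule limit_pred_iff[OF q(1) _ lim \<open>r \<in> K\<close>])
      (simp add: q(2) of_rat_divide of_rat_mult of_rat_power of_rat_minus)
  then have "{x \<in> L. limit_pred L fs fa fb x} = {\<iota> r}"
    using L_\<iota>[OF \<open>r \<in> K\<close>] by auto
  then show ?thesis
    using empty_definable_if_definable_pred[OF definable_limit_pred[OF comp]] by simp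
qed

end
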